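(* Under the standing setup below, there exist positive real numbers $r_0,\varepsilon_m,K$ and $\varepsilon_0$ (with $\varepsilon_0$ sufficiently small) such that, for every $\theta\in\mathbb R$, the following hold, where $j$ ranges over the (finitely many) integers with $U_j^\theta\neq\emptyset$ and $V_j^\theta:=B_{\varepsilon_m}(U_j^\theta)$: (PRE) the sets $U_j^\theta$ are pairwise disjoint open subsets of $\Omega$, $\overline{U_j^\theta}\subset V_j^\theta$, and $T_j^\theta:V_j^\theta\to\mathbb R^k$ is $C^2$; (PE1) $T_\theta|_{U_j^\theta}=T_j^\theta|_{U_j^\theta}$ and $B_{r_0}(T_\theta(U_j^\theta))\subset T_j^\theta(V_j^\theta)$; (PE2) $T_j^\theta$ is a $C^2$ diffeomorphism of $V_j^\theta$ onto its image, and for all $\varepsilon\in(0,\varepsilon_0)$, all $z\in T_j^\theta(V_j^\theta)$ and all $x,y\in B(z,\varepsilon)\cap T_j^\theta(V_j^\theta)$, $$\big|\det D(T_j^\theta)^{-1}(x)-\det D(T_j^\theta)^{-1}(y)\big|\le K\,\big|\det D(T_j^\theta)^{-1}(z)\big|\,\varepsilon;$$ (PE3) $m\big(\Omega\setminus\bigcup_j U_j^\theta\big)=0$; (PE4) for all $u,v\in T_j^\theta(V_j^\theta)$ with $d(u,v)\le\varepsilon_0$, $d\big((T_j^\theta)^{-1}(u),(T_j^\theta)^{-1}(v)\big)\le \sigma^{-1/2}d(u,v)$; (PE5) setting, for $x\in\mathbb R^k$ and $0<\varepsilon\le\delta$, $$G(x,\varepsilon,\delta)=\sum_j\frac{m\Big((T_j^\theta)^{-1}\big[B_\varepsilon(\partial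 T_j^\theta(U_j^\theta))\big]\cap B\big(x,(1-\sigma^{-1/2})\delta\big)\Big)}{m\Big(B\big(x,(1-\sigma^{-1/2})\delta\big)\Big)},\qquad G(\varepsilon,\delta)=\sup_{x}G(x,\varepsilon,\delta),$$ and $\eta(\delta)=\sigma^{-1/2}+2\sup_{\varepsilon\le\delta}\frac{G(\varepsilon,\delta)}{\varepsilon}\,\delta$, one has $\sup_{\delta\le\varepsilon_0}\eta(\delta)<1$.
   Context: Standing setup. Fix an integer $k\ge2$ and reals $L>0$, $\beta>0$. Let $\Phi_0:(-L-\beta,L+\beta)^k\to\mathbb R$ be $C^2$. For $n\ge1$ let $\gamma_n$ be the Lebesgue volume of the unit ball of $\mathbb R^n$. For $\sigma>1$, $Y>0$ put $\eta_0(\sigma,Y)=\sigma^{-1/2}+\frac{4}{\sqrt\sigma-1}\,Y\,\frac{\gamma_{k-1}}{\gamma_k}$ and let $S_k(Y)>1$ be the value of $\sigma$ with $\eta_0(\sigma,Y)=1$. Fix $\sigma>S_k(k+2)$ and constants $C_1,C_2>1$, and assume: $\gamma^{-2}=C_1\sigma$ (this defines $\gamma\in(0,1)$); for all $x\in(-L-\beta,L+\beta)^k$, $(\partial_1\Phi_0(x))^2\ge C_1^{k-1}C_2\sigma^k$ and $(\partial_j\Phi_0(x))^2\le\frac{(C_1-1)(C_2-1)}{k-1}\sigma$ for $2\le j\le k$. Let $\Gamma:\mathbb R^k\to\mathbb R^k$, $\Gamma(x)=(\gamma^{-(j-1)}x_j)_{j=1}^k$; $\Omega=\prod_{j=1}^k[-\gamma^{j-1}L,\gamma^{j-1}L]=\Gamma^{-1}([-L,L]^k)$;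 for $r\in[0,\beta]$, $\Omega_r=\Gamma^{-1}((-L-r,L+r)^k)$. For $\theta\in\mathbb R$, $j\in\mathbb Z$: $U_j^\theta=\{x\in\Omega_0:(2j-1)L<\theta+\Phi_0(\Gamma x)<(2j+1)L\}$ and $\Sigma_j^\theta=\{x\in\Omega:\theta+\Phi_0(\Gamma x)=(2j-1)L\}$. Define $S:\Omega_\beta\to\mathbb R^k$, $S(u)=(u_2/\gamma,\dots,u_k/\gamma,\gamma^{k-1}\Phi_0(\Gamma u))$, and $T_j^\theta(u)=S(u)+(0,\dots,0,\gamma^{k-1}(\theta-2jL))$. The map $T_\theta:\Omega\to\Omega$ is defined almost everywhere by $T_\theta=T_j^\theta$ on $U_j^\theta$ (equivalently $T_\theta(u)=(u_2/\gamma,\dots,u_k/\gamma,\gamma^{k-1}\varphi_\theta(\Gamma u))$ where $\varphi_\theta(x)=\Phi_0(x)+\theta$ reduced modulo $2L$ into $[-L,L]$). Notation: $m$ is Lebesgue measure, $d$ and $\|\cdot\|$ are Euclidean, $B(x,\varepsilon)$ is the open ball, and for $X\subset\mathbb R^k$, $B_\varepsilon(X)=\{x\in\mathbb R^k:d(x,X)<\varepsilon\}$. *)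

theory Defs
  imports "HOL-Analysis.Analysis"
begin

text \<open>R^k is modelled as real^'n with 'n a finite linearly ordered index type,
  k = CARD('n).  The paper's coordinate j (1-based) is the element of 'n at
  0-based position j-1 in the ordering.\<close>

definition pos :: "'n::{finite,linorder} \<Rightarrow> nat" where
  "pos i = card {j. j < i}"

definition crd :: "nat \<Rightarrow> 'n::{finite,linorder}" where
  "crd p = sorted_list_of_set (UNIV :: 'n set) ! p"

definition C2_on :: "'a::real_normed_vector set \<Rightarrow> ('a \<Rightarrow> 'b::real_normed_vector) \<Rightarrow> bool" where
  "C2_on S f \<longleftrightarrow> (\<exists>f' f''. (\<forall>x\<in>S. (f has_derivative blinfun_apply (f' x)) (at x)
      \<and> (f' has_derivative blinfun_apply (f'' x)) (at x)) \<and> continuous_on S f'')"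

definition C2_diffeo_on :: "'a::real_normed_vector set \<Rightarrow> ('a \<Rightarrow> 'a) \<Rightarrow> bool" where
  "C2_diffeo_on V f \<longleftrightarrow> open V \<and> C2_on V f \<and> inj_on f V \<and> open (f ` V)
      \<and> C2_on (f ` V) (inv_into V f)"

definition partial :: "(real^('n::{finite,linorder}) \<Rightarrow> real) \<Rightarrow> nat \<Rightarrow> real^('n::{finite,linorder}) \<Rightarrow> real" where
  "partial \<Phi> p x = frechet_derivative \<Phi> (at x) (axis (crd p) 1)"

definition jac_det :: "(real^'n \<Rightarrow> real^'n) \<Rightarrow> real^'n \<Rightarrow> real" where
  "jac_det g x = det (matrix (frechet_derivative g (at x)))"

definition nbhd :: "real \<Rightarrow> 'a::metric_space set \<Rightarrow> 'a set" where
  "nbhd \<epsilon> X = {x. \<exists>y\<in>X. dist x y < \<epsilon>}"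

definition eta0 :: "nat \<Rightarrow> real \<Rightarrow> real \<Rightarrow> real" where
  "eta0 k \<sigma> Y = \<sigma> powr (-1/2) + 4 / (sqrt \<sigma> - 1) * Y * (unit_ball_vol (real k - 1) / unit_ball_vol (real k))"

definition Sk :: "nat \<Rightarrow> real \<Rightarrow> real" where
  "Sk k Y = (THE s. s > 1 \<and> eta0 k s Y = 1)"

definition ocube :: "real \<Rightarrow> (real^'n) set" where
  "ocube r = {x. \<forall>i. \<bar>x $ i\<bar> < r}"

definition ccube :: "real \<Rightarrow> (real^'n) set" where
  "ccube r = {x. \<forall>i. \<bar>x $ i\<bar> \<le> r}"

definition Gam :: "real \<Rightarrow> real^('n::{finite,linorder}) \<Rightarrow> real^('n::{finite,linorder})" where
  "Gam \<gamma> x = (\<chi> i. x $ i / \<gamma> ^ pos i)"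

definition Omega :: "real \<Rightarrow> real \<Rightarrow> (real^('n::{finite,linorder})) set" where
  "Omega \<gamma> L = {x. Gam \<gamma> x \<in> ccube L}"

definition Omega_r :: "real \<Rightarrow> real \<Rightarrow> real \<Rightarrow> (real^('n::{finite,linorder})) set" where
  "Omega_r \<gamma> L r = {x. Gam \<gamma> x \<in> ocube (L + r)}"

definition Uset :: "real \<Rightarrow> real \<Rightarrow> (real^('n::{finite,linorder}) \<Rightarrow> real) \<Rightarrow> real \<Rightarrow> int \<Rightarrow> (real^('n::{finite,linorder})) set" where
  "Uset \<gamma> L \<Phi> \<theta> j = {x \<in> Omega_r \<gamma> L 0.
      (2 * of_int j - 1) * L < \<theta> + \<Phi> (Gam \<gamma> x) \<and> \<theta> + \<Phi> (Gam \<gamma> x) < (2 * of_int j + 1) * L}"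

definition Smap :: "real \<Rightarrow> (real^('n::{finite,linorder}) \<Rightarrow> real) \<Rightarrow> real^('n::{finite,linorder}) \<Rightarrow> real^('n::{finite,linorder})" where
  "Smap \<gamma> \<Phi> u = (\<chi> i. if pos i + 1 < CARD('n) then u $ crd (pos i + 1) / \<gamma>
      else \<gamma> ^ (CARD('n) - 1) * \<Phi> (Gam \<gamma> u))"

definition Tj :: "real \<Rightarrow> real \<Rightarrow> (real^('n::{finite,linorder}) \<Rightarrow> real) \<Rightarrow> real \<Rightarrow> int \<Rightarrow> real^('n::{finite,linorder}) \<Rightarrow> real^('n::{finite,linorder})" where
  "Tj \<gamma> L \<Phi> \<theta> j u = Smap \<gamma> \<Phi> u +
      (\<chi> i. if pos i + 1 = CARD('n) then \<gamma> ^ (CARD('n) - 1) * (\<theta> - 2 * of_int j * L) else 0)"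

text \<open>phi_theta: Phi + theta reduced modulo 2L into [-L,L) (boundary convention
  only affects a null set).\<close>
definition phi_red :: "real \<Rightarrow> (real^'n \<Rightarrow> real) \<Rightarrow> real \<Rightarrow> real^'n \<Rightarrow> real" where
  "phi_red L \<Phi> \<theta> x = \<Phi> x + \<theta> - 2 * L * of_int \<lfloor>(\<Phi> x + \<theta> + L) / (2 * L)\<rfloor>"

definition Ttheta :: "real \<Rightarrow> real \<Rightarrow> (real^('n::{finite,linorder}) \<Rightarrow> real) \<Rightarrow> real \<Rightarrow> real^('n::{finite,linorder}) \<Rightarrow> real^('n::{finite,linorder})" where
  "Ttheta \<gamma> L \<Phi> \<theta> u = (\<chi> i. if pos i + 1 < CARD('n) then u $ crd (pos i + 1) / \<gamma>
      else \<gamma> ^ (CARD('n) - 1) * phi_red L \<Phi> \<theta> (Gam \<gamma> u))"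

definition Vset :: "real \<Rightarrow> real \<Rightarrow> (real^('n::{finite,linorder}) \<Rightarrow> real) \<Rightarrow> real \<Rightarrow> real \<Rightarrow> int \<Rightarrow> (real^('n::{finite,linorder})) set" where
  "Vset \<gamma> L \<Phi> \<theta> \<epsilon>m j = nbhd \<epsilon>m (Uset \<gamma> L \<Phi> \<theta> j)"

definition Jset :: "real \<Rightarrow> real \<Rightarrow> (real^('n::{finite,linorder}) \<Rightarrow> real) \<Rightarrow> real \<Rightarrow> int set" where
  "Jset \<gamma> L \<Phi> \<theta> = {j. Uset \<gamma> L \<Phi> \<theta> j \<noteq> {}}"

definition Gx :: "real \<Rightarrow> real \<Rightarrow> (real^('n::{finite,linorder}) \<Rightarrow> real) \<Rightarrow> real \<Rightarrow> real \<Rightarrow> real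
    \<Rightarrow> real^('n::{finite,linorder}) \<Rightarrow> real \<Rightarrow> real \<Rightarrow> real" where
  "Gx \<gamma> L \<Phi> \<theta> \<sigma> \<epsilon>m x \<epsilon> \<delta> =
     (\<Sum>j\<in>Jset \<gamma> L \<Phi> \<theta>.
        measure lebesgue ({v \<in> Vset \<gamma> L \<Phi> \<theta> \<epsilon>m j.
             Tj \<gamma> L \<Phi> \<theta> j v \<in> nbhd \<epsilon> (frontier (Tj \<gamma> L \<Phi> \<theta> j ` Uset \<gamma> L \<Phi> \<theta> j))}
           \<inter> ball x ((1 - \<sigma> powr (-1/2)) * \<delta>))
        / measure lebesgue (ball x ((1 - \<sigma> powr (-1/2)) * \<delta>)))"

definition Gsup :: "real \<Rightarrow> real \<Rightarrow> (real^('n::{finite,linorder}) \<Rightarrow> real) \<Rightarrow> real \<Rightarrow> real \<Rightarrow> real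
    \<Rightarrow> real \<Rightarrow> real \<Rightarrow> ereal" where
  "Gsup \<gamma> L \<Phi> \<theta> \<sigma> \<epsilon>m \<epsilon> \<delta> = (SUP x. ereal (Gx \<gamma> L \<Phi> \<theta> \<sigma> \<epsilon>m x \<epsilon> \<delta>))"

definition eta :: "real \<Rightarrow> real \<Rightarrow> (real^('n::{finite,linorder}) \<Rightarrow> real) \<Rightarrow> real \<Rightarrow> real \<Rightarrow> real
    \<Rightarrow> real \<Rightarrow> ereal" where
  "eta \<gamma> L \<Phi> \<theta> \<sigma> \<epsilon>m \<delta> = ereal (\<sigma> powr (-1/2))
     + 2 * (SUP \<epsilon>\<in>{0<..\<delta>}. Gsup \<gamma> L \<Phi> \<theta> \<sigma> \<epsilon>m \<epsilon> \<delta> / ereal \<epsilon>) * ereal \<delta>"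

end

theory Submission
  imports Defs
begin

text \<open>
  The last coordinate of S is the only nonlinear one, so the mean value theorem for the scalar
  function \<Phi>0 at a single intermediate point shows that S expands distances by sqrt \<sigma> on the whole
  box; injectivity, contraction and smoothness of the inverse branches, and the Jacobian distortion
  follow from this together with compactness.

  For (PE5), a point counted by the branch j lies within \<epsilon> / sqrt \<sigma> of a face of \<Omega>, or its image lies
  within \<epsilon> of a discontinuity level; it can be counted by two branches only in the latter case, and
  never by three.  A small ball meets one face of each of the k opposite pairs and one level, so the
  sum in G is at most k + 2 volumes of sets all of whose slices in some coordinate direction have
  length at most 2 \<epsilon> / sqrt \<sigma>.  Each is bounded by Fubini via the (k-1)-dimensional shadow of the ball,
  and the total is exactly the expression in eta0 at (\<sigma>, k + 2).
\<close>

section \<open>C2 maps and inverses of expanding maps\<close>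

text \<open>The rescaling \<open>Gam\<close> is what makes S expand. The first k - 1 coordinates of
  S stretch u_2, ..., u_k by 1 / \<gamma> = sqrt (C1 * \<sigma>), more than the required sqrt
  \<sigma>; the coordinate u_1 that the shift discards survives only inside \<Phi>0, where the large
  first partial derivative recovers it. The other partials can work against this, and the surplus C1
  - 1 in the stretched coordinates pays for them. Every branch is S plus a constant vector, so all
  bounds are taken once, for S on a compact box slightly larger than \<Omega>, and are uniform in
  \<theta> and j. In (PE5) slices are thin only if no line inside the ball reaches two opposite
  faces or two levels. The first depends on the side lengths of \<Omega>, the second on a Lipschitz
  bound B for S; both are excluded once (1 + B) * \<delta> is at most half the gap between levels.
  The ratio of shadow to ball is a constant over the radius (1 - \<sigma> powr (-1/2)) * \<delta>,
  so \<epsilon> and \<delta> cancel in \<open>eta\<close>.\<close>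

interpretation blinfun_compose: bounded_bilinear "(o\<^sub>L)"
  by (rule bounded_bilinear_blinfun_compose)

lemma blinfun_compose_assoc: "(a o\<^sub>L b) o\<^sub>L c = a o\<^sub>L (b o\<^sub>L c)"
  by (rule blinfun_eqI) simp

text \<open>With \<open>f y = f x + (f y - f x)\<close> the second part contributes o(1) times O(|y
  - x|), because \<open>g\<close> vanishes at \<open>x\<close>; hence continuity of \<open>f\<close>
  suffices. This differentiates the inverse of a derivative at a stage where only its continuity is
  known.\<close>

lemma has_derivative_product_vanishing:
  assumes B: "bounded_bilinear B"
    and f: "isCont f x" and g: "(g has_derivative g') (at x)" and g0: "g x = 0"
  shows "((\<lambda>y. B (f y) (g y)) has_derivative (\<lambda>h. B (f x) (g' h))) (at x)"
proof -
  interpret B: bounded_bilinear B by (rule B)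
  have 1: "((\<lambda>y. B (f x) (g y)) has_derivative (\<lambda>h. B (f x) (g' h))) (at x)"
    by (rule bounded_linear.has_derivative[OF B.bounded_linear_right g])
  have 2: "((\<lambda>y. B (f y - f x) (g y)) has_derivative (\<lambda>h. 0)) (at x)"
  proof -
    obtain K where K: "K > 0" "\<And>a b. norm (B a b) \<le> norm a * norm b * K"
      using B.pos_bounded by blast
    obtain e M where M: "e > 0" "\<And>y. dist y x < e \<Longrightarrow> norm (g y) \<le> M * norm (y - x)"
    proof -
      from g obtain M where M: "M > 0" "\<And>h. norm (g' h) \<le> norm h * M"
        using bounded_linear.pos_bounded has_derivative_bounded_linear by blast
      have "\<forall>e>0. \<exists>d>0. \<forall>y. norm (y - x) < d \<longrightarrow> norm (g y - g x - g' (y - x)) \<le> e * norm (y - x)"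
        using g unfolding has_derivative_at_alt by auto
      then obtain d where d: "d > 0" "\<And>y. norm (y - x) < d \<Longrightarrow> norm (g y - g x - g' (y - x)) \<le> 1 * norm (y - x)"
        using zero_less_one by blast
      show ?thesis
      proof (rule that[OF d(1), of "M + 1"])
        fix y assume "dist y x < d"
        then have "norm (g y - g' (y - x)) \<le> norm (y - x)"
          using d(2)[of y] g0 by (simp add: dist_norm)
        then show "norm (g y) \<le> (M + 1) * norm (y - x)"
          using M(2)[of "y - x"] norm_triangle_ineq2[of "g y" "g' (y - x)"] by (simp add: algebra_simps)
      qed
    qed
    have Mn: "norm (B (f y - f x) (g y)) \<le> norm (f y - f x) * (\<bar>M\<bar> * norm (y - x)) * K" if "dist y x < e" for y
    proof -
      have "norm (g y) \<le> \<bar>M\<bar> * norm (y - x)"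
        using M(2)[OF that] mult_right_mono[of M "\<bar>M\<bar>" "norm (y - x)"] by force
      then show ?thesis
        using K(1) by (intro order_trans[OF K(2)] mult_right_mono mult_left_mono) auto
    qed
    show ?thesis
      unfolding has_derivative_at_alt
    proof (intro conjI allI impI)
      fix r :: real assume r: "r > 0"
      have "(\<lambda>y. norm (f y - f x) * (\<bar>M\<bar> * K)) \<midarrow>x\<rightarrow> norm (f x - f x) * (\<bar>M\<bar> * K)"
        using f unfolding isCont_def by (intro tendsto_intros)
      then have "(\<lambda>y. norm (f y - f x) * (\<bar>M\<bar> * K)) \<midarrow>x\<rightarrow> 0" by simp
      from LIM_D[OF this r] obtain s where s: "s > 0"
        "\<And>y. y \<noteq> x \<Longrightarrow> norm (y - x) < s \<Longrightarrow> norm (f y - f x) * (\<bar>M\<bar> * K) < r"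
        by fastforce
      have s': "norm (f y - f x) * (\<bar>M\<bar> * K) \<le> r" if "norm (y - x) < s" for y
        using s(2)[of y] that r by (cases "y = x") (auto intro: less_imp_le)
      show "\<exists>d>0. \<forall>y. norm (y - x) < d \<longrightarrow> norm (B (f y - f x) (g y) - B (f x - f x) (g x) - 0) \<le> r * norm (y - x)"
      proof (intro exI[of _ "min s e"] conjI allI impI)
        show "min s e > 0" using s M by simp
        fix y assume y: "norm (y - x) < min s e"
        have "norm (B (f y - f x) (g y)) \<le> norm (f y - f x) * (\<bar>M\<bar> * K) * norm (y - x)"
          using Mn[of y] y by (simp add: dist_norm algebra_simps)
        also have "\<dots> \<le> r * norm (y - x)" using s'[of y] y by (intro mult_right_mono) auto
        finally show "norm (B (f y - f x) (g y) - B (f x - f x) (g x) - 0) \<le> r * norm (y - x)"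
          by (simp add: g0 B.zero_right)
      qed
    qed simp
  qed
  show ?thesis
    using has_derivative_add[OF 1 2] by (simp add: B.diff_left)
qed

section \<open>Stability of C2 maps under sums and linear maps\<close>

lemma C2_on_subset: "C2_on S f \<Longrightarrow> T \<subseteq> S \<Longrightarrow> C2_on T f"
  unfolding C2_on_def by (meson continuous_on_subset subsetD)

lemma C2_on_add:
  assumes "C2_on S f" "C2_on S g" shows "C2_on S (\<lambda>x. f x + g x)"
proof -
  obtain f' f'' g' g'' where
    "\<And>x. x \<in> S \<Longrightarrow> (f has_derivative blinfun_apply (f' x)) (at x)"
    "\<And>x. x \<in> S \<Longrightarrow> (f' has_derivative blinfun_apply (f'' x)) (at x)" "continuous_on S f''"
    "\<And>x. x \<in> S \<Longrightarrow> (g has_derivative blinfun_apply (g' x)) (at x)"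
    "\<And>x. x \<in> S \<Longrightarrow> (g' has_derivative blinfun_apply (g'' x)) (at x)" "continuous_on S g''"
    using assms unfolding C2_on_def by metis
  then show ?thesis unfolding C2_on_def
    by (intro exI[of _ "\<lambda>x. f' x + g' x"] exI[of _ "\<lambda>x. f'' x + g'' x"])
       (auto simp: plus_blinfun.rep_eq intro!: has_derivative_add continuous_intros)
qed

lemma C2_on_const: "C2_on S (\<lambda>x. c)"
  unfolding C2_on_def by (intro exI[of _ "\<lambda>x. 0"] exI[of _ "\<lambda>x. 0"]) (auto simp: zero_blinfun.rep_eq)

lemma C2_on_bounded_linear:
  assumes "bounded_linear A" shows "C2_on S A"
  unfolding C2_on_def
  by (intro exI[of _ "\<lambda>x. Blinfun A"] exI[of _ "\<lambda>x. 0"])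
     (auto simp: bounded_linear_Blinfun_apply[OF assms] zero_blinfun.rep_eq intro: bounded_linear_imp_has_derivative assms)

lemma C2_on_linear_compose:
  assumes f: "C2_on S f" and A: "bounded_linear A" and G: "bounded_linear G"
    and sub: "\<And>x. x \<in> T \<Longrightarrow> G x \<in> S"
  shows "C2_on T (\<lambda>x. A (f (G x)))"
proof -
  obtain f' f'' where f':
    "\<And>x. x \<in> S \<Longrightarrow> (f has_derivative blinfun_apply (f' x)) (at x)"
    "\<And>x. x \<in> S \<Longrightarrow> (f' has_derivative blinfun_apply (f'' x)) (at x)" and c: "continuous_on S f''"
    using f unfolding C2_on_def by metis
  define bA where "bA = Blinfun A"
  define bG where "bG = Blinfun G"
  have A_eq: "A = blinfun_apply bA" and G_eq: "G = blinfun_apply bG"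
    using A G by (auto simp: bA_def bG_def bounded_linear_Blinfun_apply)
  \<comment> \<open>\<open>Q\<close> is the linear operation sending a derivative X to A X G;
    applied to f'' it yields the second derivative of the composite.\<close>
  define Q where "Q = blinfun_compose.prod_left bG o\<^sub>L blinfun_compose.prod_right bA"
  have Q: "blinfun_apply Q X = bA o\<^sub>L X o\<^sub>L bG" for X by (simp add: Q_def)
  have GT: "continuous_on T G"
    by (rule linear_continuous_on[OF G])
  have dG: "(G has_derivative blinfun_apply bG) (at x)" for x
    unfolding G_eq by (rule bounded_linear_imp_has_derivative) (rule blinfun.bounded_linear_right)
  have "((\<lambda>x. A (f (G x))) has_derivative blinfun_apply (bA o\<^sub>L f' (G x) o\<^sub>L bG)) (at x)" if "x \<in> T" for x
    using has_derivative_compose[OF dG f'(1)[OF sub[OF that]]]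
    unfolding A_eq
    by (auto dest!: bounded_linear.has_derivative[OF blinfun.bounded_linear_right[of bA]] simp: o_def blinfun_compose.rep_eq)
  moreover have "((\<lambda>x. bA o\<^sub>L f' (G x) o\<^sub>L bG) has_derivative blinfun_apply (Q o\<^sub>L f'' (G x) o\<^sub>L bG)) (at x)"
    if "x \<in> T" for x
    using has_derivative_compose[OF dG f'(2)[OF sub[OF that]]]
    by (auto dest!: bounded_linear.has_derivative[OF blinfun.bounded_linear_right[of Q]] simp: o_def Q blinfun_compose.rep_eq)
  moreover have "continuous_on T (\<lambda>x. Q o\<^sub>L f'' (G x) o\<^sub>L bG)"
    by (intro continuous_intros continuous_on_compose2[OF c GT]) (use sub in auto)
  ultimately show ?thesis unfolding C2_on_def
    by (intro exI[of _ "\<lambda>x. bA o\<^sub>L f' (G x) o\<^sub>L bG"] exI[of _ "\<lambda>x. Q o\<^sub>L f'' (G x) o\<^sub>L bG"]) simp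
qed

section \<open>Inverses of expanding maps\<close>

lemma has_derivative_expanding:
  assumes f: "(f has_derivative f') (at x)" and "open V" "x \<in> V"
    and exp: "\<And>y. y \<in> V \<Longrightarrow> c * dist x y \<le> dist (f x) (f y)"
  shows "c * norm h \<le> norm (f' h)"
proof (cases "h = 0")
  case True
  then show ?thesis using f has_derivative_bounded_linear linear_simps(3) by fastforce
next
  case False
  interpret f': bounded_linear f' using f by (rule has_derivative_bounded_linear)
  show ?thesis
  proof (rule field_le_epsilon)
    fix e :: real assume e: "e > 0"
    have "e / norm h > 0" using e False by simp
    then obtain d where d: "d > 0" "\<And>y. norm (y - x) < d \<Longrightarrow> norm (f y - f x - f' (y - x)) \<le> e / norm h * norm (y - x)"
      using f unfolding has_derivative_at_alt by blast
    obtain r where r: "r > 0" "ball x r \<subseteq> V" using assms(2,3) open_contains_ball by blast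
    \<comment> \<open>This \<open>t\<close> keeps x + t h inside the ball contained in
      \<open>V\<close> and inside the radius \<open>d\<close> where the remainder is at most e * t;
      dividing by t transfers the expansion to \<open>f'\<close>.\<close>
    define t where "t = min d r / (2 * norm h)"
    have t: "t > 0" "t * norm h < d" "t * norm h < r"
      using d r False by (auto simp: t_def min_def)
    let ?y = "x + t *\<^sub>R h"
    have "c * (t * norm h) \<le> norm (f ?y - f x)"
      using exp[of ?y] r t by (auto simp: dist_norm subset_iff norm_minus_commute)
    also have "\<dots> \<le> norm (f' (t *\<^sub>R h)) + norm (f ?y - f x - f' (t *\<^sub>R h))"
      by (metis add.commute diff_add_cancel norm_triangle_ineq)
    also have "norm (f ?y - f x - f' (t *\<^sub>R h)) \<le> e / norm h * norm (t *\<^sub>R h)"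
      using d(2)[of ?y] t by simp
    also have "norm (f' (t *\<^sub>R h)) + e / norm h * norm (t *\<^sub>R h) = t * (norm (f' h) + e)"
      using False t by (simp add: f'.scaleR field_simps)
    finally have "t * (c * norm h) \<le> t * (norm (f' h) + e)" by (simp add: algebra_simps)
    then show "c * norm h \<le> norm (f' h) + e" using t(1) by simp
  qed
qed

text \<open>Expansion makes \<open>f\<close> injective, so invariance of domain gives the open
  image, and it makes the inverse Lipschitz, hence continuous. The derivative inherits the
  expansion, so it is injective and, in finite dimension, invertible. The two-sided identities and
  the bound 1 / c for \<open>N\<close> are recorded for the second differentiation.\<close>

lemma expanding_inverse_has_derivative:
  fixes f :: "'a::euclidean_space \<Rightarrow> 'a" and f' :: "'a \<Rightarrow> 'a \<Rightarrow>\<^sub>L 'a"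
  assumes V: "open V" and c: "c > 0"
    and exp: "\<And>x y. x \<in> V \<Longrightarrow> y \<in> V \<Longrightarrow> c * dist x y \<le> dist (f x) (f y)"
    and f': "\<And>x. x \<in> V \<Longrightarrow> (f has_derivative blinfun_apply (f' x)) (at x)"
  shows "open (f ` V)" "inj_on f V"
    "\<exists>N. \<forall>y\<in>f ` V. (inv_into V f has_derivative blinfun_apply (N y)) (at y) \<and>
      N y o\<^sub>L f' (inv_into V f y) = id_blinfun \<and> f' (inv_into V f y) o\<^sub>L N y = id_blinfun \<and>
      norm (N y) \<le> 1 / c"
proof -
  show inj: "inj_on f V"
    using exp c by (intro inj_onI) (metis dist_eq_0_iff dist_le_zero_iff mult_le_cancel_left_pos mult_zero_right)
  have cont: "continuous_on V f"
    using f' has_derivative_continuous continuous_at_imp_continuous_on by blast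
  show op: "open (f ` V)" by (rule invariance_of_domain[OF cont V inj])
  let ?g = "inv_into V f"
  have gV: "?g y \<in> V" "f (?g y) = y" if "y \<in> f ` V" for y
    using that by (auto simp: inv_into_into f_inv_into_f)
  have gl: "dist (?g y) (?g z) \<le> 1 / c * dist y z" if "y \<in> f ` V" "z \<in> f ` V" for y z
    using exp[OF gV(1)[OF that(1)] gV(1)[OF that(2)]] gV that c by (simp add: field_simps)
  have gc: "continuous_on (f ` V) ?g"
    by (rule lipschitz_on_continuous_on[of "1/c"]) (use gl c in \<open>auto intro!: lipschitz_onI\<close>)
  have ex: "c * norm h \<le> norm (blinfun_apply (f' x) h)" if "x \<in> V" for x h
    using has_derivative_expanding[OF f'[OF that] V that] exp that by blast
  have "\<exists>n. n o\<^sub>L f' x = id_blinfun \<and> f' x o\<^sub>L n = id_blinfun \<and> norm n \<le> 1 / c" if x: "x \<in> V" for x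
  proof -
    have lin: "linear (blinfun_apply (f' x))"
      by (simp add: blinfun.bounded_linear_right bounded_linear.linear)
    have "inj (blinfun_apply (f' x))"
      unfolding linear_injective_0[OF lin]
      using ex[OF x] c by (metis mult_pos_pos norm_zero not_less zero_less_norm_iff)
    then obtain n where n: "linear n" "\<And>h. n (f' x h) = h" "\<And>h. f' x (n h) = h"
      using linear_injective_isomorphism[OF lin] by blast
    then have bn: "blinfun_apply (Blinfun n) = n"
      by (simp add: bounded_linear_Blinfun_apply linear_conv_bounded_linear)
    have "norm (n h) \<le> 1 / c * norm h" for h
      using ex[OF x, of "n h"] n(3)[of h] c by (simp add: field_simps)
    then have "norm (Blinfun n) \<le> 1 / c"
      using c by (intro norm_blinfun_bound) (auto simp: bn)
    then show ?thesis
      by (intro exI[of _ "Blinfun n"]) (auto intro!: blinfun_eqI simp: bn n)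
  qed
  then obtain n where n: "\<And>x. x \<in> V \<Longrightarrow> n x o\<^sub>L f' x = id_blinfun"
    "\<And>x. x \<in> V \<Longrightarrow> f' x o\<^sub>L n x = id_blinfun" "\<And>x. x \<in> V \<Longrightarrow> norm (n x) \<le> 1 / c"
    by metis
  define N where "N y = n (?g y)" for y
  have d: "(?g has_derivative blinfun_apply (N y)) (at y)" if y: "y \<in> f ` V" for y
  proof (rule has_derivative_inverse_basic[where g="?g", OF f'[OF gV(1)[OF y]] _ _ _ op y])
    show "bounded_linear (blinfun_apply (N y))" by (rule blinfun.bounded_linear_right)
    have "blinfun_apply (N y o\<^sub>L f' (?g y)) h = h" for h
      using n(1)[OF gV(1)[OF y]] by (simp add: N_def)
    then show "blinfun_apply (N y) \<circ> blinfun_apply (f' (?g y)) = id" by (auto simp: fun_eq_iff)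
    show "continuous (at y) ?g" using gc op y continuous_on_eq_continuous_at by blast
  qed (use gV in auto)
  show "\<exists>N. \<forall>y\<in>f ` V. (?g has_derivative blinfun_apply (N y)) (at y) \<and>
      N y o\<^sub>L f' (?g y) = id_blinfun \<and> f' (?g y) o\<^sub>L N y = id_blinfun \<and> norm (N y) \<le> 1 / c"
    using d n gV by (intro exI[of _ N]) (simp add: N_def)
qed

text \<open>With M the derivative of f at the preimage and N its inverse, everything follows from
  the resolvent identity N y - N z = - N y (M y - M z) N z (\<open>key\<close>). The uniform bound 1
  / c turns it into continuity of N; its right side has a factor vanishing at y = z, so it can then
  be differentiated there.\<close>

lemma C2_diffeo_on_expanding:
  fixes f :: "'a::euclidean_space \<Rightarrow> 'a"
  assumes V: "open V" and c: "c > 0" and f: "C2_on V f"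
    and exp: "\<And>x y. x \<in> V \<Longrightarrow> y \<in> V \<Longrightarrow> c * dist x y \<le> dist (f x) (f y)"
  shows "C2_diffeo_on V f"
proof -
  obtain f' f'' where f':
    "\<And>x. x \<in> V \<Longrightarrow> (f has_derivative blinfun_apply (f' x)) (at x)"
    and f'': "\<And>x. x \<in> V \<Longrightarrow> (f' has_derivative blinfun_apply (f'' x)) (at x)" and cf: "continuous_on V f''"
    using f unfolding C2_on_def by metis
  let ?g = "inv_into V f"
  have op: "open (f ` V)" and inj: "inj_on f V"
    using expanding_inverse_has_derivative(1,2)[OF V c] exp f' by blast+
  obtain N where N_all: "\<forall>y\<in>f ` V. (?g has_derivative blinfun_apply (N y)) (at y) \<and>
      N y o\<^sub>L f' (?g y) = id_blinfun \<and> f' (?g y) o\<^sub>L N y = id_blinfun \<and> norm (N y) \<le> 1 / c"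
    using expanding_inverse_has_derivative(3)[of V c f f', OF V c] exp f' by (elim meta_impE exE) auto
  have N: "(?g has_derivative blinfun_apply (N y)) (at y)" and NM: "N y o\<^sub>L f' (?g y) = id_blinfun"
    and MN: "f' (?g y) o\<^sub>L N y = id_blinfun" and Nb: "norm (N y) \<le> 1 / c" if "y \<in> f ` V" for y
    using bspec[OF N_all that] by simp_all
  define M where "M y = f' (?g y)" for y
  have gV: "?g y \<in> V" if "y \<in> f ` V" for y using that by (rule inv_into_into)
  have M': "(M has_derivative blinfun_apply (f'' (?g y) o\<^sub>L N y)) (at y)" if "y \<in> f ` V" for y
    using has_derivative_compose[OF N[OF that] f''[OF gV[OF that]]] by (simp add: M_def[abs_def] o_def blinfun_compose.rep_eq)
  have key: "N y = N z + - (N y o\<^sub>L ((M y - M z) o\<^sub>L N z))" if "y \<in> f ` V" "z \<in> f ` V" for y z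
  proof -
    have "N y o\<^sub>L (M y o\<^sub>L N z) = N z" "N y o\<^sub>L (M z o\<^sub>L N z) = N y"
      using NM[OF that(1)] MN[OF that(2)]
      by (simp_all add: M_def blinfun_compose_assoc[symmetric])
         (simp_all add: blinfun_eqI blinfun_compose_assoc)
    then show ?thesis by (simp add: blinfun_compose.diff_left blinfun_compose.diff_right)
  qed
  have cN: "isCont N z" if z: "z \<in> f ` V" for z
  proof -
    have cM: "isCont M z" using M'[OF z] has_derivative_continuous by blast
    have ev: "eventually (\<lambda>y. y \<in> f ` V) (at z)" using op z by (rule eventually_at_in_open')
    have "((\<lambda>y. N y - N z) \<longlongrightarrow> 0) (at z)"
    proof (rule Lim_null_comparison)
      show "eventually (\<lambda>y. norm (N y - N z) \<le> 1 / c * (norm (M y - M z) * (1 / c))) (at z)"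
        using ev
      proof eventually_elim
        case (elim y)
        have "norm (N y - N z) = norm (N y o\<^sub>L ((M y - M z) o\<^sub>L N z))"
          by (subst key[OF elim z]) simp
        also have "\<dots> \<le> norm (N y) * (norm (M y - M z) * norm (N z))"
          by (intro order_trans[OF norm_blinfun_compose] mult_left_mono norm_blinfun_compose) auto
        also have "\<dots> \<le> 1 / c * (norm (M y - M z) * (1 / c))"
          using Nb[OF elim] Nb[OF z] c by (intro mult_mono) auto
        finally show ?case .
      qed
      have "((\<lambda>y. 1 / c * (norm (M y - M z) * (1 / c))) \<longlongrightarrow> 1 / c * (norm (M z - M z) * (1 / c))) (at z)"
        using cM unfolding isCont_def by (intro tendsto_intros)
      then show "((\<lambda>y. 1 / c * (norm (M y - M z) * (1 / c))) \<longlongrightarrow> 0) (at z)" by simp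
    qed
    then show ?thesis unfolding isCont_def by (rule LIM_zero_cancel)
  qed
  \<comment> \<open>The derivative of operator inversion, h -> - N (dM h) N, with dM given by the
    chain rule; written by compositions of bounded linear maps so that continuity in y can be read
    off.\<close>
  define Q where "Q y = - (blinfun_compose.prod_left (N y) o\<^sub>L blinfun_compose.prod_right (N y))
      o\<^sub>L (f'' (?g y) o\<^sub>L N y)" for y
  have N': "(N has_derivative blinfun_apply (Q z)) (at z)" if z: "z \<in> f ` V" for z
  proof -
    have "((\<lambda>y. (M y - M z) o\<^sub>L N z) has_derivative (\<lambda>h. (f'' (?g z) o\<^sub>L N z) h o\<^sub>L N z)) (at z)"
      by (rule bounded_linear.has_derivative[OF blinfun_compose.bounded_linear_left])
         (use has_derivative_diff[OF M'[OF z] has_derivative_const[of "M z"]] in simp)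
    then have "((\<lambda>y. N y o\<^sub>L ((M y - M z) o\<^sub>L N z)) has_derivative
        (\<lambda>h. N z o\<^sub>L ((f'' (?g z) o\<^sub>L N z) h o\<^sub>L N z))) (at z)"
      by (intro has_derivative_product_vanishing[OF bounded_bilinear_blinfun_compose cN[OF z]]) auto
    moreover have "blinfun_apply (Q z) = (\<lambda>h. - (N z o\<^sub>L ((f'' (?g z) o\<^sub>L N z) h o\<^sub>L N z)))"
      by (simp add: Q_def fun_eq_iff blinfun.bilinear_simps blinfun_compose_assoc)
    ultimately
    have "((\<lambda>y. N z + - (N y o\<^sub>L ((M y - M z) o\<^sub>L N z))) has_derivative blinfun_apply (Q z)) (at z)"
      using has_derivative_add[OF has_derivative_const[of "N z"] has_derivative_minus] by fastforce
    then show ?thesis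
      by (rule has_derivative_transform_within_open[OF _ op z]) (use key z in metis)
  qed
  have cNo: "continuous_on (f ` V) N" using cN by (simp add: continuous_at_imp_continuous_on)
  have cg: "continuous_on (f ` V) ?g"
    using N by (meson continuous_at_imp_continuous_on has_derivative_continuous)
  have "continuous_on (f ` V) Q" unfolding Q_def
    by (intro continuous_intros cNo continuous_on_compose2[OF cf cg]
        bounded_linear.continuous_on[OF blinfun_compose.bounded_linear_prod_left]
        bounded_linear.continuous_on[OF blinfun_compose.bounded_linear_prod_right]) (use gV in auto)
  then have "C2_on (f ` V) ?g" unfolding C2_on_def using N N'
    by (intro exI[of _ N] exI[of _ Q]) simp
  then show ?thesis unfolding C2_diffeo_on_def using V f op inj by blast
qed

section \<open>Sets with thin slices\<close>

text \<open>The hypothesis \<open>slice\<close> bounds the diameter of E on each line parallel to b,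
  hence its length there. Dropping the b-coordinate can only shrink the norm, so the lines that meet
  E are indexed by points of the ball of radius R in one dimension less.\<close>

lemma emeasure_le_of_thin_slices:
  fixes E :: "'a::euclidean_space set"
  assumes E: "E \<in> sets borel" and sub: "E \<subseteq> ball 0 R" and R: "R > 0"
    and b: "b \<in> Basis" and l: "l \<ge> 0"
    and slice: "\<And>p t. p \<in> E \<Longrightarrow> p + t *\<^sub>R b \<in> E \<Longrightarrow> \<bar>t\<bar> \<le> l"
  shows "emeasure lborel E \<le> ennreal (l * (unit_ball_vol (real DIM('a) - 1) * R ^ (DIM('a) - 1)))"
proof -
  let ?I = "Basis - {b}"
  \<comment> \<open>Vectors are rebuilt from their coordinates, so that Lebesgue measure becomes a
    product over \<open>Basis\<close> and the factor of b can be integrated on its own.\<close>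
  define P :: "('a \<Rightarrow> real) \<Rightarrow> 'a" where "P f = (\<Sum>c\<in>Basis. f c *\<^sub>R c)" for f
  interpret product_sigma_finite "\<lambda>_::'a. lborel :: real measure" by standard
  have [measurable]: "P \<in> measurable (Pi\<^sub>M Basis (\<lambda>_. lborel)) borel"
    unfolding P_def by measurable
  note E[measurable]
  have ins: "insert b ?I = Basis" using b by auto
  let ?D = "{f. sqrt (\<Sum>i\<in>?I. (f i)\<^sup>2) \<le> R} \<inter> space (Pi\<^sub>M ?I (\<lambda>_. lborel :: real measure))"
  have D: "?D \<in> sets (Pi\<^sub>M ?I (\<lambda>_. lborel))" by measurable
  have Pupd: "P (f(b := y)) = P (f(b := z)) + (y - z) *\<^sub>R b" for f y z
  proof -
    have "P (f(b := w)) = w *\<^sub>R b + (\<Sum>c\<in>?I. f c *\<^sub>R c)" for w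
      unfolding P_def by (subst sum.remove[OF _ b]) (auto intro!: sum.cong)
    then show ?thesis by (simp add: algebra_simps)
  qed
  have inner_le: "(\<integral>\<^sup>+ y. indicator E (P (f(b := y))) \<partial>lborel) \<le> ennreal l * indicator ?D f"
    if f: "f \<in> space (Pi\<^sub>M ?I (\<lambda>_. lborel :: real measure))" for f
  proof (cases "\<exists>y. P (f(b := y)) \<in> E")
    case False
    then have "(\<integral>\<^sup>+ y. indicator E (P (f(b := y))) \<partial>lborel) = (\<integral>\<^sup>+ (y::real). 0 \<partial>lborel)"
      by (intro nn_integral_cong) (auto simp: indicator_def)
    then show ?thesis by simp
  next
    case True
    then obtain z where z: "P (f(b := z)) \<in> E" by blast
    have "f \<in> ?D"
    proof -
      have "norm (P (f(b := z))) < R" using z sub by auto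
      moreover have "norm (P (f(b := z))) = sqrt (\<Sum>i\<in>Basis. ((f(b := z)) i)\<^sup>2)"
        using euclidean_dist_l2[of "P (f(b := z))" 0] by (simp add: L2_set_def P_def)
      moreover have "(\<Sum>i\<in>?I. (f i)\<^sup>2) \<le> (\<Sum>i\<in>Basis. ((f(b := z)) i)\<^sup>2)"
        by (subst sum.remove[OF finite_Basis b, of "\<lambda>i. ((f(b := z)) i)\<^sup>2"])
           (auto intro!: sum_mono add_increasing)
      ultimately have "sqrt (\<Sum>i\<in>?I. (f i)\<^sup>2) \<le> R"
        by (smt (verit) real_sqrt_le_mono)
      then show ?thesis using f by simp
    qed
    define A where "A = {y. P (f(b := y)) \<in> E}"
    have dA: "\<bar>y - z\<bar> \<le> l" if "y \<in> A" "z \<in> A" for y z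
      using slice[of "P (f(b := z))" "y - z"] that Pupd[of f y z] by (simp add: A_def)
    have bdd: "bdd_below A" "A \<noteq> {}"
      using dA[of _ z] z by (auto simp: A_def abs_le_iff algebra_simps intro!: bdd_belowI[of _ "z - l"])
    \<comment> \<open>No element of the slice lies more than l below y, so y - l is a lower bound
      and the interval starting at the infimum reaches y.\<close>
    have "A \<subseteq> {Inf A .. Inf A + l}"
    proof
      fix y assume y: "y \<in> A"
      have "y - l \<le> Inf A" using dA[OF y] bdd by (intro cInf_greatest) (auto simp: abs_le_iff algebra_simps)
      then show "y \<in> {Inf A .. Inf A + l}" using cInf_lower[OF y bdd(1)] by auto
    qed
    then have "(\<integral>\<^sup>+ y. indicator E (P (f(b := y))) \<partial>lborel) \<le> (\<integral>\<^sup>+ y. indicator {Inf A .. Inf A + l} y \<partial>lborel)"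
      by (intro nn_integral_mono) (auto simp: indicator_def A_def)
    also have "\<dots> = ennreal l" using l by simp
    finally show ?thesis using \<open>f \<in> ?D\<close> by simp
  qed
  have "emeasure lborel E = emeasure (distr (Pi\<^sub>M Basis (\<lambda>_. lborel)) borel P) E"
    using lborel_eq[where 'a='a] by (simp add: P_def[abs_def])
  also have "\<dots> = (\<integral>\<^sup>+ x. indicator E x \<partial>(distr (Pi\<^sub>M Basis (\<lambda>_. lborel)) borel P))"
    using E by simp
  also have "\<dots> = (\<integral>\<^sup>+ f. indicator E (P f) \<partial>(Pi\<^sub>M Basis (\<lambda>_. lborel)))"
    by (subst nn_integral_distr) auto
  also have "\<dots> = (\<integral>\<^sup>+ f. indicator E (P f) \<partial>(Pi\<^sub>M (insert b ?I) (\<lambda>_. lborel)))"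
    by (simp only: ins)
  also have "\<dots> = (\<integral>\<^sup>+ f. (\<integral>\<^sup>+ y. indicator E (P (f(b := y))) \<partial>lborel) \<partial>(Pi\<^sub>M ?I (\<lambda>_. lborel)))"
  proof (rule product_nn_integral_insert)
    show "(\<lambda>f. indicator E (P f)) \<in> borel_measurable (Pi\<^sub>M (insert b ?I) (\<lambda>_. lborel))"
      unfolding ins by measurable
  qed auto
  also have "\<dots> \<le> (\<integral>\<^sup>+ f. ennreal l * indicator ?D f \<partial>(Pi\<^sub>M ?I (\<lambda>_. lborel)))"
    by (rule nn_integral_mono) (rule inner_le)
  also have "\<dots> = ennreal l * emeasure (Pi\<^sub>M ?I (\<lambda>_. lborel)) ?D"
    using D by (rule nn_integral_cmult_indicator)
  also have "\<dots> = ennreal l * ennreal (unit_ball_vol (real (card ?I)) * R ^ card ?I)"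
    by (subst emeasure_cball_aux) (use R in auto)
  also have "card ?I = DIM('a) - 1" using b by simp
  also have "real (DIM('a) - 1) = real DIM('a) - 1"
    using DIM_positive[where 'a='a] by (simp add: of_nat_diff)
  finally show ?thesis using l by (simp add: ennreal_mult')
qed

text \<open>Translation to the origin, and passage to the completed measure in which
  \<open>Gx\<close> is written.\<close>

lemma measure_le_of_thin_slices:
  fixes E :: "'a::euclidean_space set"
  assumes E: "E \<in> sets borel" and sub: "E \<subseteq> ball x R" and R: "R > 0"
    and b: "b \<in> Basis" and l: "l \<ge> 0"
    and slice: "\<And>p t. p \<in> E \<Longrightarrow> p + t *\<^sub>R b \<in> E \<Longrightarrow> \<bar>t\<bar> \<le> l"
  shows "measure lebesgue E \<le> l * (unit_ball_vol (real DIM('a) - 1) * R ^ (DIM('a) - 1))"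
proof -
  let ?F = "(\<lambda>p. - x + p) ` E"
  have nn: "0 \<le> l * (unit_ball_vol (real DIM('a) - 1) * R ^ (DIM('a) - 1))"
    using l R DIM_positive[where 'a='a] by (intro mult_nonneg_nonneg unit_ball_vol_nonneg) auto
  have F: "?F = (\<lambda>p. x + p) -` E" by (force simp: image_iff)
  have "?F \<in> sets borel"
    unfolding F using measurable_sets[of "\<lambda>p. x + p" borel borel E] E by simp
  then have "emeasure lborel ?F \<le> ennreal (l * (unit_ball_vol (real DIM('a) - 1) * R ^ (DIM('a) - 1)))"
  proof (rule emeasure_le_of_thin_slices[OF _ _ R b l])
    show "?F \<subseteq> ball 0 R" using sub by (auto simp: dist_norm norm_minus_commute)
    show "\<bar>t\<bar> \<le> l" if "p \<in> ?F" "p + t *\<^sub>R b \<in> ?F" for p t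
      using that slice[of "x + p" t] unfolding F by (simp add: algebra_simps)
  qed
  then have "measure lborel ?F \<le> l * (unit_ball_vol (real DIM('a) - 1) * R ^ (DIM('a) - 1))"
    using nn unfolding measure_def by (simp add: enn2real_leI)
  moreover have "measure lebesgue ?F = measure lebesgue E" by (rule measure_translation)
  moreover have "measure lebesgue ?F = measure lborel ?F"
    using \<open>?F \<in> sets borel\<close> by (simp add: measure_completion)
  ultimately show ?thesis by simp
qed

section \<open>Expansion of S\<close>

lemma bij_betw_pos: "bij_betw pos (UNIV :: 'n::{finite,linorder} set) {..<CARD('n)}"
proof -
  have lt: "pos i < pos j" if "i < j" for i j :: 'n
  proof -
    have "{k. k < i} \<subset> {k. k < j}" using that by (auto simp: psubset_eq set_eq_iff)
    then show ?thesis unfolding pos_def by (rule psubset_card_mono[OF finite])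
  qed
  have inj: "inj (pos :: 'n \<Rightarrow> nat)"
  proof (rule injI)
    fix i j :: 'n assume "pos i = pos j"
    then show "i = j" using lt[of i j] lt[of j i] by (cases i j rule: linorder_cases) auto
  qed
  have "range (pos :: 'n \<Rightarrow> nat) \<subseteq> {..<CARD('n)}"
  proof (rule image_subsetI)
    fix i :: 'n
    have "{j. j < i} \<subset> UNIV" by (auto simp: psubset_eq set_eq_iff)
    then have "card {j. j < i} < card (UNIV :: 'n set)" by (rule psubset_card_mono[OF finite])
    then show "pos i \<in> {..<CARD('n)}" by (simp add: pos_def)
  qed
  then have "range (pos :: 'n \<Rightarrow> nat) = {..<CARD('n)}"
    by (intro card_subset_eq) (auto simp: card_image[OF inj])
  then show ?thesis using inj by (simp add: bij_betw_def)
qed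

lemma pos_less: "pos (i :: 'n::{finite,linorder}) < CARD('n)"
  using bij_betw_pos[where 'n='n] by (auto simp: bij_betw_def)

lemma pos_crd: "p < CARD('n) \<Longrightarrow> pos (crd p :: 'n::{finite,linorder}) = p"
proof -
  assume p: "p < CARD('n)"
  let ?l = "sorted_list_of_set (UNIV :: 'n set)"
  have len: "length ?l = CARD('n)" by simp
  have st: "sorted_wrt (<) ?l" by simp
  \<comment> \<open>In a strictly sorted list the entries below the one at index p are exactly the
    first p, so counting them returns p.\<close>
  have "{j. j < ?l ! p} = (!) ?l ` {..<p}"
  proof (intro equalityI subsetI)
    fix j assume j: "j \<in> {j. j < ?l ! p}"
    have "j \<in> set ?l" by simp
    then obtain q where q: "q < CARD('n)" "j = ?l ! q" by (metis in_set_conv_nth len)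
    have "\<not> p < q" using sorted_wrt_nth_less[OF st, of p q] q j len by auto
    moreover have "p \<noteq> q" using j q by auto
    ultimately have "q < p" by simp
    then show "j \<in> (!) ?l ` {..<p}" using q by auto
  next
    fix j assume "j \<in> (!) ?l ` {..<p}"
    then show "j \<in> {j. j < ?l ! p}" using sorted_wrt_nth_less[OF st] p len by auto
  qed
  moreover have "inj_on ((!) ?l) {..<p}"
    using p len by (intro inj_on_nth) auto
  ultimately show ?thesis unfolding pos_def crd_def by (simp add: card_image)
qed

lemma crd_pos: "crd (pos i) = i"
  by (rule injD[OF bij_betw_imp_inj_on[OF bij_betw_pos]]) (simp add: pos_crd pos_less)

lemma sum_UNIV_crd:
  "(\<Sum>i\<in>(UNIV :: 'n::{finite,linorder} set). f i) = (\<Sum>p<CARD('n). f (crd p))"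
  using sum.reindex_bij_betw[OF bij_betw_pos[where 'n='n], of "\<lambda>p. f (crd p)"] by (simp add: crd_pos)

lemma ocube_eq_box: "ocube r = (box (\<chi> i. - r) (\<chi> i. r) :: (real^'n) set)"
  unfolding ocube_def set_eq_iff mem_box_cart mem_Collect_eq vec_lambda_beta abs_less_iff
  by (metis minus_less_iff)

text \<open>The weights 1 / C2 and 1 / (C2 - 1) below come from (p + w)^2 \<ge> (1 - t) p^2 - (1 / t - 1) w^2
  with t = (C2 - 1) / C2.\<close>

lemma expansion_inequality:
  fixes h a :: "nat \<Rightarrow> real"
  assumes s: "s > 0" and C: "C1 > 1" "C2 > 1"
    and a0: "(a 0)\<^sup>2 \<ge> C2 * s"
    and a: "\<And>p. p < m \<Longrightarrow> (a (Suc p))\<^sup>2 \<le> (C1 - 1) * (C2 - 1) / real m * s"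
  shows "s * (\<Sum>p<Suc m. (h p)\<^sup>2) \<le> C1 * s * (\<Sum>p<m. (h (Suc p))\<^sup>2) + (\<Sum>p<Suc m. a p * h p)\<^sup>2"
proof -
  define H where "H = (\<Sum>p<m. (h (Suc p))\<^sup>2)"
  define w where "w = (\<Sum>p<m. a (Suc p) * h (Suc p))"
  define q where "q = a 0 * h 0"
  have H: "H \<ge> 0" unfolding H_def by (simp add: sum_nonneg)
  \<comment> \<open>The m partial derivatives share one budget (C1 - 1) * (C2 - 1) * s, whence the
    division by m in the hypothesis; for m = 0 the sum is empty.\<close>
  have "(\<Sum>p<m. (a (Suc p))\<^sup>2) \<le> (\<Sum>p<m. (C1 - 1) * (C2 - 1) / real m * s)"
    using a by (intro sum_mono) auto
  also have "\<dots> \<le> (C1 - 1) * (C2 - 1) * s" using C s by (cases "m = 0") auto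
  finally have "w\<^sup>2 \<le> (C1 - 1) * (C2 - 1) * s * H"
    using Cauchy_Schwarz_ineq_sum[of "\<lambda>p. a (Suc p)" "\<lambda>p. h (Suc p)" "{..<m}"] H
    unfolding w_def H_def by (meson mult_right_mono order_trans)
  then have w: "w\<^sup>2 / (C2 - 1) \<le> (C1 - 1) * s * H"
    using C by (simp add: field_simps)
  have "C2 * s * (h 0)\<^sup>2 \<le> q\<^sup>2"
    using mult_right_mono[OF a0, of "(h 0)\<^sup>2"] by (simp add: q_def power_mult_distrib)
  then have q: "s * (h 0)\<^sup>2 \<le> q\<^sup>2 / C2" using C by (simp add: field_simps)
  \<comment> \<open>This square over C2 * (C2 - 1) is precisely the slack in the weighted bound for
    (q + w)^2. The resulting loss (C1 - 1) * s * H is covered by the term C1 * s * H of the claim,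
    which leaves s * H.\<close>
  have "0 \<le> ((C2 - 1) * q + C2 * w)\<^sup>2 / (C2 * (C2 - 1))" using C by simp
  also have "\<dots> = (q + w)\<^sup>2 - (q\<^sup>2 / C2 - w\<^sup>2 / (C2 - 1))"
    using C by (simp add: divide_simps) (simp add: power2_eq_square algebra_simps)
  finally have "(q + w)\<^sup>2 \<ge> s * (h 0)\<^sup>2 - (C1 - 1) * s * H" using w q by simp
  moreover have "(\<Sum>p<Suc m. a p * h p) = q + w" "(\<Sum>p<Suc m. (h p)\<^sup>2) = (h 0)\<^sup>2 + H"
    unfolding q_def w_def H_def by (simp_all only: sum.lessThan_Suc_shift)
  ultimately show ?thesis unfolding H_def[symmetric] by (simp add: algebra_simps)
qed

lemma Gam_linear: "linear (Gam \<gamma>)"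
  by (rule linearI) (auto simp: Gam_def vec_eq_iff add_divide_distrib)

text \<open>In terms of h = u - v the shifted coordinates contribute C1 * \<sigma> times the squares
  of all coordinates but the first, and the last coordinate is a linear form in h with coefficients
  \<open>a p\<close>. This is the situation of \<open>expansion_inequality\<close> with m = k -
  1.\<close>

lemma Smap_expanding:
  fixes \<Phi>0 :: "real^('n::{finite,linorder}) \<Rightarrow> real" and u v :: "real^('n::{finite,linorder})"
  assumes k2: "CARD('n) \<ge> 2"
    and diff: "\<And>x. x \<in> ocube r \<Longrightarrow> \<Phi>0 differentiable (at x)"
    and sigma: "\<sigma> > 1" and C1: "C1 > 1" and C2: "C2 > 1"
    and gam: "\<gamma> > 0" "1 / \<gamma>^2 = C1 * \<sigma>"
    and d1: "\<forall>x\<in>ocube r. (partial \<Phi>0 0 x)^2 \<ge> C1 ^ (CARD('n) - 1) * C2 * \<sigma> ^ CARD('n)"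
    and dj: "\<forall>x\<in>ocube r. \<forall>p. 1 \<le> p \<and> p < CARD('n) \<longrightarrow>
               (partial \<Phi>0 p x)^2 \<le> (C1 - 1) * (C2 - 1) / (real CARD('n) - 1) * \<sigma>"
    and u: "Gam \<gamma> u \<in> ocube r" and v: "Gam \<gamma> v \<in> ocube r"
  shows "sqrt \<sigma> * dist u v \<le> dist (Smap \<gamma> \<Phi>0 u) (Smap \<gamma> \<Phi>0 v)"
proof -
  define m where "m = CARD('n) - 1"
  have k: "CARD('n) = Suc m" "m \<ge> 1" using k2 by (auto simp: m_def)
  interpret Gam: linear "Gam \<gamma>" by (rule Gam_linear)
  define h where "h = u - v"
  define H where "H = Gam \<gamma> h"
  have Huv: "H = Gam \<gamma> u - Gam \<gamma> v" by (simp add: H_def h_def Gam.diff)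
  define D where "D x = frechet_derivative \<Phi>0 (at x)" for x
  have D: "(\<Phi>0 has_derivative D x) (at x)" if "x \<in> ocube r" for x
    using diff[OF that] by (simp add: D_def frechet_derivative_works)
  obtain \<xi> where \<xi>: "\<xi> \<in> ocube r" "\<Phi>0 (Gam \<gamma> u) - \<Phi>0 (Gam \<gamma> v) = D \<xi> H"
  proof -
    have seg: "Gam \<gamma> v + t *\<^sub>R H \<in> ocube r" if "0 \<le> t" "t \<le> 1" for t
    proof -
      have "(1 - t) *\<^sub>R Gam \<gamma> v + t *\<^sub>R Gam \<gamma> u \<in> ocube r"
        using convexD_alt[OF convex_box(2) v[unfolded ocube_eq_box] u[unfolded ocube_eq_box]] that
        unfolding ocube_eq_box by auto
      then show ?thesis by (simp add: Huv algebra_simps)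
    qed
    have "\<exists>t\<in>{0<..<1}. \<Phi>0 (Gam \<gamma> v + 1 *\<^sub>R H) - \<Phi>0 (Gam \<gamma> v + 0 *\<^sub>R H)
        = (\<lambda>s. D (Gam \<gamma> v + t *\<^sub>R H) (s *\<^sub>R H)) (1 - 0)"
    proof (rule mvt_simple)
      fix t :: real assume t: "0 \<le> t" "t \<le> 1"
      have "((\<lambda>t. Gam \<gamma> v + t *\<^sub>R H) has_derivative (\<lambda>s. s *\<^sub>R H)) (at t within {0..1})"
        by (auto intro!: derivative_eq_intros)
      from has_derivative_compose[OF this D[OF seg[OF t]]]
      show "((\<lambda>t. \<Phi>0 (Gam \<gamma> v + t *\<^sub>R H)) has_derivative (\<lambda>s. D (Gam \<gamma> v + t *\<^sub>R H) (s *\<^sub>R H)))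
          (at t within {0..1})"
        .
    qed simp
    then obtain t where "0 < t" "t < 1" "\<Phi>0 (Gam \<gamma> u) - \<Phi>0 (Gam \<gamma> v) = D (Gam \<gamma> v + t *\<^sub>R H) H"
      by (auto simp: Huv)
    then show ?thesis using that[of "Gam \<gamma> v + t *\<^sub>R H"] seg[of t] by simp
  qed
  have linD: "linear (D \<xi>)" using D[OF \<xi>(1)] by (rule has_derivative_linear)
  \<comment> \<open>The factor \<gamma>^m comes from the last coordinate of S, and \<gamma>^(-p)
    from \<open>Gam\<close>.\<close>
  define a where "a p = \<gamma> ^ (m - p) * partial \<Phi>0 p \<xi>" for p
  define hh where "hh p = h $ (crd p :: 'n)" for p
  have "D \<xi> H = D \<xi> (\<Sum>i\<in>UNIV. H $ i *\<^sub>R axis i 1)"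
    using basis_expansion[of H] by (simp add: scalar_mult_eq_scaleR)
  also have "\<dots> = (\<Sum>i\<in>UNIV. H $ i * D \<xi> (axis i 1))"
    by (simp add: linear_sum[OF linD] linear_cmul[OF linD])
  also have "\<dots> = (\<Sum>p<Suc m. hh p / \<gamma> ^ p * partial \<Phi>0 p \<xi>)"
    unfolding sum_UNIV_crd k(1)
    by (intro sum.cong) (auto simp: H_def Gam_def hh_def pos_crd k partial_def D_def)
  finally have DH: "D \<xi> H = (\<Sum>p<Suc m. hh p / \<gamma> ^ p * partial \<Phi>0 p \<xi>)" .
  have last: "\<gamma> ^ m * D \<xi> H = (\<Sum>p<Suc m. a p * hh p)"
    unfolding DH sum_distrib_left
  proof (intro sum.cong refl)
    fix p assume "p \<in> {..<Suc m}"
    then have "\<gamma> ^ m = \<gamma> ^ (m - p) * \<gamma> ^ p" by (simp add: power_add[symmetric])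
    then show "\<gamma> ^ m * (hh p / \<gamma> ^ p * partial \<Phi>0 p \<xi>) = a p * hh p"
      using gam by (simp add: a_def)
  qed
  let ?w = "Smap \<gamma> \<Phi>0 u - Smap \<gamma> \<Phi>0 v"
  have w1: "?w $ (crd p :: 'n) = hh (Suc p) / \<gamma>" if "p < m" for p
    using that k by (simp add: Smap_def pos_crd hh_def h_def diff_divide_distrib)
  have w2: "?w $ (crd m :: 'n) = \<gamma> ^ m * D \<xi> H"
    using k \<xi>(2) by (simp add: Smap_def pos_crd right_diff_distrib[symmetric])
  have nw: "(norm ?w)\<^sup>2 = C1 * \<sigma> * (\<Sum>p<m. (hh (Suc p))\<^sup>2) + (\<Sum>p<Suc m. a p * hh p)\<^sup>2"
  proof -
    have "(norm ?w)\<^sup>2 = (\<Sum>p<Suc m. (?w $ (crd p :: 'n))\<^sup>2)"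
      unfolding norm_vec_def L2_set_def sum_UNIV_crd k(1)
      by (subst real_sqrt_pow2) (auto simp del: sum.lessThan_Suc intro!: sum_nonneg)
    also have "\<dots> = (\<Sum>p<m. (?w $ (crd p :: 'n))\<^sup>2) + (\<gamma> ^ m * D \<xi> H)\<^sup>2"
      using w2 by simp
    also have "(\<Sum>p<m. (?w $ (crd p :: 'n))\<^sup>2) = (\<Sum>p<m. C1 * \<sigma> * (hh (Suc p))\<^sup>2)"
      using w1 by (intro sum.cong) (auto simp: power_divide gam(2)[symmetric])
    finally show ?thesis using last by (simp add: sum_distrib_left)
  qed
  have nh: "(norm h)\<^sup>2 = (\<Sum>p<Suc m. (hh p)\<^sup>2)"
    unfolding norm_vec_def L2_set_def sum_UNIV_crd k(1) hh_def
    by (subst real_sqrt_pow2) (auto simp del: sum.lessThan_Suc intro!: sum_nonneg)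
  have g2: "\<gamma>\<^sup>2 = 1 / (C1 * \<sigma>)" by (simp add: gam(2)[symmetric])
  have "C1 * \<sigma> > 1" using C1 sigma by (simp add: less_1_mult)
  then have "\<gamma>\<^sup>2 \<le> 1" by (simp add: g2)
  then have g1: "\<gamma> \<le> 1" by (intro power2_le_imp_le[of \<gamma> 1]) auto
  have a0: "(a 0)\<^sup>2 \<ge> C2 * \<sigma>"
  proof -
    have "(a 0)\<^sup>2 = (\<gamma>\<^sup>2) ^ m * (partial \<Phi>0 0 \<xi>)\<^sup>2"
      by (simp add: a_def power_mult_distrib power_mult[symmetric] mult.commute)
    also have "\<dots> \<ge> (\<gamma>\<^sup>2) ^ m * (C1 ^ m * C2 * \<sigma> ^ Suc m)"
      using bspec[OF d1 \<xi>(1)] unfolding k(1) by (intro mult_left_mono) auto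
    \<comment> \<open>Since \<gamma>^2 * C1 * \<sigma> = 1, the powers in the bound on the first
      partial derivative cancel and leave C2 * \<sigma>.\<close>
    also have "(\<gamma>\<^sup>2) ^ m * (C1 ^ m * C2 * \<sigma> ^ Suc m) = (\<gamma>\<^sup>2 * (C1 * \<sigma>)) ^ m * (C2 * \<sigma>)"
      by (simp add: power_mult_distrib mult_ac)
    also have "\<gamma>\<^sup>2 * (C1 * \<sigma>) = 1" using C1 sigma by (simp add: g2)
    finally show ?thesis by simp
  qed
  have ap: "(a (Suc p))\<^sup>2 \<le> (C1 - 1) * (C2 - 1) / real m * \<sigma>" if "p < m" for p
  proof -
    have "(a (Suc p))\<^sup>2 = (\<gamma> ^ (m - Suc p))\<^sup>2 * (partial \<Phi>0 (Suc p) \<xi>)\<^sup>2"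
      by (simp add: a_def power_mult_distrib)
    also have "\<dots> \<le> 1 * (partial \<Phi>0 (Suc p) \<xi>)\<^sup>2"
      using gam g1 by (intro mult_right_mono) (auto simp: abs_square_le_1 power_le_one)
    also have "\<dots> \<le> (C1 - 1) * (C2 - 1) / real m * \<sigma>"
      using dj[rule_format, OF \<xi>(1), of "Suc p"] that k by simp
    finally show ?thesis .
  qed
  have "\<sigma> * (norm h)\<^sup>2 \<le> (norm ?w)\<^sup>2"
    unfolding nw nh using sigma by (intro expansion_inequality[OF _ C1 C2 a0 ap]) auto
  then have "(sqrt \<sigma> * norm h)\<^sup>2 \<le> (norm ?w)\<^sup>2"
    using sigma by (simp add: power_mult_distrib)
  then show ?thesis
    unfolding dist_norm h_def[symmetric] by (rule power2_le_imp_le) simp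
qed

section \<open>The threshold for \<sigma>\<close>

text \<open>Both summands of \<open>eta0\<close> decrease. This makes the number described by
  \<open>Sk\<close> unique and turns \<sigma> > \<open>Sk\<close> into \<open>eta0\<close> <
  1.\<close>

lemma eta0_strict_antimono:
  assumes "k \<ge> 1" "Y > 0" "1 < s" "s < t"
  shows "eta0 k t Y < eta0 k s Y"
proof -
  have "sqrt s < sqrt t" "1 < sqrt s" using assms by auto
  moreover have "0 < Y * (unit_ball_vol (real k - 1) / unit_ball_vol (real k))"
    using assms by (intro mult_pos_pos divide_pos_pos unit_ball_vol_pos) auto
  moreover have "t powr (-1/2) < s powr (-1/2)" using assms by (intro powr_less_mono2_neg) auto
  moreover have "4 / (sqrt t - 1) < 4 / (sqrt s - 1)" using calculation by (simp add: field_simps)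
  ultimately show ?thesis unfolding eta0_def mult.assoc
    by (intro add_strict_mono mult_strict_right_mono)
qed

lemma powr_minus_half: "s > 0 \<Longrightarrow> s powr (-1/2) = 1 / sqrt s"
  by (simp add: powr_half_sqrt[symmetric] powr_minus_divide)

text \<open>\<open>Sk\<close> is a definite description, so existence has to be shown as well. In t
  = sqrt s the equation reads 1 / t + c / (t - 1) = 1, that is t^2 - (2 + c) t + 1 = 0, and the
  larger root exceeds 1.\<close>

lemma Sk_less_imp:
  assumes "k \<ge> 1" "Y > 0" "\<sigma> > Sk k Y"
  shows "\<sigma> > 1" "eta0 k \<sigma> Y < 1"
proof -
  define c where "c = 4 * (Y * (unit_ball_vol (real k - 1) / unit_ball_vol (real k)))"
  have c: "c > 0"
    unfolding c_def using assms by (intro mult_pos_pos divide_pos_pos unit_ball_vol_pos) auto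
  define q where "q = sqrt ((2 + c)\<^sup>2 - 4)"
  have "(2 + c)\<^sup>2 - 4 \<ge> 0" using c by (simp add: power2_eq_square algebra_simps)
  then have q: "q \<ge> 0" "q\<^sup>2 = (2 + c)\<^sup>2 - 4" by (simp_all add: q_def)
  define t where "t = (2 + c + q) / 2"
  have t: "t > 1" unfolding t_def using q(1) c by simp
  have "t * t - (2 + c) * t + 1 = (q\<^sup>2 - ((2 + c)\<^sup>2 - 4)) / 4"
    unfolding t_def by (simp add: power2_eq_square field_simps)
  also have "\<dots> = 0" using q(2) by simp
  finally have "t * t - (2 + c) * t + 1 = 0" .
  then have "1 / t + c / (t - 1) = 1" using t by (simp add: field_simps)
  moreover have "t\<^sup>2 powr (-1/2) = 1 / t" using powr_minus_half[of "t\<^sup>2"] t by simp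
  ultimately have e: "eta0 k (t\<^sup>2) Y = 1" using t by (simp add: eta0_def c_def mult_ac)
  have t2: "t\<^sup>2 > 1" using t by (simp add: power_strict_increasing_iff one_less_power)
  have "Sk k Y = t\<^sup>2" unfolding Sk_def
  proof (rule the_equality)
    fix s assume s: "1 < s \<and> eta0 k s Y = 1"
    show "s = t\<^sup>2"
      using eta0_strict_antimono[OF assms(1,2), of s "t\<^sup>2"] eta0_strict_antimono[OF assms(1,2), of "t\<^sup>2" s] s e t2
      by (metis less_irrefl linorder_neqE)
  qed (use e t2 in auto)
  then show "\<sigma> > 1" "eta0 k \<sigma> Y < 1"
    using assms t2 e eta0_strict_antimono[OF assms(1,2), of "t\<^sup>2" \<sigma>] by auto
qed

section \<open>Boxes and branches\<close>

lemma mem_Omega_iff: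
  assumes "\<gamma> > 0" shows "x \<in> Omega \<gamma> L \<longleftrightarrow> (\<forall>i. \<bar>x $ i\<bar> \<le> L * \<gamma> ^ pos i)"
  using assms by (simp add: Omega_def ccube_def Gam_def pos_divide_le_eq)

lemma mem_Omega_r_iff:
  assumes "\<gamma> > 0" shows "x \<in> Omega_r \<gamma> L r \<longleftrightarrow> (\<forall>i. \<bar>x $ i\<bar> < (L + r) * \<gamma> ^ pos i)"
  using assms by (simp add: Omega_r_def ocube_def Gam_def pos_divide_less_eq)

lemma compact_Omega:
  assumes "\<gamma> > 0" shows "compact (Omega \<gamma> L :: (real^('n::{finite,linorder})) set)"
    and "convex (Omega \<gamma> L :: (real^('n::{finite,linorder})) set)"
proof -
  have "(Omega \<gamma> L :: ((real, 'n) vec) set) = cbox (\<chi> i. - (L * \<gamma> ^ pos i)) (\<chi> i. L * \<gamma> ^ pos i)"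
    unfolding set_eq_iff mem_Omega_iff[OF assms] mem_box_cart vec_lambda_beta abs_le_iff
    by (metis minus_le_iff)
  then show "compact (Omega \<gamma> L :: ((real, 'n) vec) set)" "convex (Omega \<gamma> L :: ((real, 'n) vec) set)"
    by (simp_all add: compact_cbox)
qed

lemma open_Omega_r:
  assumes "\<gamma> > 0" shows "open (Omega_r \<gamma> L r :: (real^('n::{finite,linorder})) set)"
proof -
  have "(Omega_r \<gamma> L r :: ((real, 'n) vec) set) = box (\<chi> i. - ((L + r) * \<gamma> ^ pos i)) (\<chi> i. (L + r) * \<gamma> ^ pos i)"
    unfolding set_eq_iff mem_Omega_r_iff[OF assms] mem_box_cart vec_lambda_beta abs_less_iff
    by (metis minus_less_iff)
  then show ?thesis by (simp add: open_box)
qed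

lemma Omega_r_subset_Omega: "\<gamma> > 0 \<Longrightarrow> Omega_r \<gamma> L r \<subseteq> Omega \<gamma> (L + r)"
  by (auto simp: mem_Omega_iff mem_Omega_r_iff less_imp_le)

lemma Omega_subset_Omega_r:
  assumes "\<gamma> > 0" "M < L + r" shows "Omega \<gamma> M \<subseteq> Omega_r \<gamma> L r"
proof
  fix x assume "x \<in> Omega \<gamma> M"
  then have "\<bar>x $ i\<bar> < (L + r) * \<gamma> ^ pos i" for i
    using assms mult_strict_right_mono[OF assms(2), of "\<gamma> ^ pos i"]
    by (auto simp: mem_Omega_iff intro: le_less_trans)
  then show "x \<in> Omega_r \<gamma> L r" using assms by (simp add: mem_Omega_r_iff)
qed

lemma nbhd_eq_UN_ball: "nbhd e X = (\<Union>x\<in>X. ball x e)"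
  by (auto simp: nbhd_def dist_commute)

lemma open_nbhd: "open (nbhd e X)"
  by (auto simp: nbhd_eq_UN_ball)

lemma closure_subset_nbhd: "e > 0 \<Longrightarrow> closure X \<subseteq> nbhd e X"
  by (auto simp: nbhd_def closure_approachable dist_commute)

lemma C2_on_imp_continuous_on: "C2_on S f \<Longrightarrow> continuous_on S f"
  unfolding C2_on_def by (meson continuous_at_imp_continuous_on has_derivative_continuous)

text \<open>S is a linear map plus the scalar \<Phi>(\<open>Gam\<close> u) times a fixed vector in
  the last direction, so addition and composition with linear maps suffice.\<close>

lemma C2_on_Smap:
  fixes \<Phi> :: "real^('n::{finite,linorder}) \<Rightarrow> real"
  assumes "C2_on (ocube (L + r)) \<Phi>"
  shows "C2_on (Omega_r \<gamma> L r) (Smap \<gamma> \<Phi>)"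
proof -
  define A :: "(real, 'n) vec \<Rightarrow> (real, 'n) vec"
    where "A u = (\<chi> i. if pos i + 1 < CARD('n) then u $ crd (pos i + 1) / \<gamma> else 0)" for u
  define b :: "(real, 'n) vec"
    where "b = (\<chi> i. if pos i + 1 < CARD('n) then 0 else \<gamma> ^ (CARD('n) - 1))"
  have "linear A" by (rule linearI) (auto simp: A_def vec_eq_iff add_divide_distrib)
  then have A: "C2_on (Omega_r \<gamma> L r) A"
    by (intro C2_on_bounded_linear) (simp add: linear_conv_bounded_linear)
  have "C2_on (Omega_r \<gamma> L r) (\<lambda>u. \<Phi> (Gam \<gamma> u) *\<^sub>R b)"
    by (rule C2_on_linear_compose[OF assms bounded_linear_scaleR_left])
       (auto simp: Omega_r_def linear_conv_bounded_linear[symmetric] Gam_linear)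
  from C2_on_add[OF A this] show ?thesis
    by (rule back_subst[of "C2_on _"]) (auto simp: A_def b_def Smap_def vec_eq_iff)
qed

text \<open>The bounds on the partial derivatives act from here on only through
  \<open>expand\<close>. Since \<theta> and j are arguments and not parameters, a constant obtained
  before they are fixed is uniform in both.\<close>

locale expanding_family =
  fixes \<Phi>0 :: "real^('n::{finite,linorder}) \<Rightarrow> real"
    and L \<beta> \<sigma> \<gamma> :: real
  assumes L: "L > 0" and \<beta>: "\<beta> > 0" and \<sigma>: "\<sigma> > 1" and \<gamma>: "\<gamma> > 0" "\<gamma> \<le> 1"
    and k2: "CARD('n) \<ge> 2"
    and C2Phi: "C2_on (ocube (L + \<beta>)) \<Phi>0"
    and expand: "u \<in> Omega_r \<gamma> L \<beta> \<Longrightarrow> v \<in> Omega_r \<gamma> L \<beta> \<Longrightarrow>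
      sqrt \<sigma> * dist u v \<le> dist (Smap \<gamma> \<Phi>0 u) (Smap \<gamma> \<Phi>0 v)"
begin

text \<open>The margin of \<open>Omega_r\<close> in coordinate i is scaled by \<gamma> ^ pos i,
  smallest at the last index. A quarter of \<beta> keeps the neighbourhoods V inside the box with
  margin \<beta> / 2, whose closure is a compact subset of the domain where S is C2.\<close>

definition \<epsilon>m :: real where "\<epsilon>m = \<gamma> ^ (CARD('n) - 1) * \<beta> / 4"

abbreviation S :: "(real, 'n) vec \<Rightarrow> (real, 'n) vec" where "S \<equiv> Smap \<gamma> \<Phi>0"
abbreviation T :: "real \<Rightarrow> int \<Rightarrow> (real, 'n) vec \<Rightarrow> (real, 'n) vec" where "T \<equiv> Tj \<gamma> L \<Phi>0"
abbreviation U :: "real \<Rightarrow> int \<Rightarrow> ((real, 'n) vec) set" where "U \<equiv> Uset \<gamma> L \<Phi>0"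
abbreviation V :: "real \<Rightarrow> int \<Rightarrow> ((real, 'n) vec) set" where "V \<theta> \<equiv> Vset \<gamma> L \<Phi>0 \<theta> \<epsilon>m"
abbreviation J :: "real \<Rightarrow> int set" where "J \<equiv> Jset \<gamma> L \<Phi>0"

definition shift :: "real \<Rightarrow> int \<Rightarrow> (real, 'n) vec" where
  "shift \<theta> j = (\<chi> i. if pos i + 1 = CARD('n) then \<gamma> ^ (CARD('n) - 1) * (\<theta> - 2 * of_int j * L) else 0)"

text \<open>The branches are translates of one map, so distances between images, and derivatives, do
  not depend on \<theta> or j.\<close>

lemma T_eq: "T \<theta> j = (\<lambda>u. S u + shift \<theta> j)"
  by (simp add: fun_eq_iff Tj_def shift_def)

lemma dist_T: "dist (T \<theta> j u) (T \<theta> j v) = dist (S u) (S v)"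
  by (simp add: T_eq)

lemma expand_T:
  "u \<in> Omega_r \<gamma> L \<beta> \<Longrightarrow> v \<in> Omega_r \<gamma> L \<beta> \<Longrightarrow> sqrt \<sigma> * dist u v \<le> dist (T \<theta> j u) (T \<theta> j v)"
  using expand by (simp add: dist_T)

lemma C2_S: "C2_on (Omega_r \<gamma> L \<beta>) S"
  by (rule C2_on_Smap[OF C2Phi])

lemma C2_T: "C2_on (Omega_r \<gamma> L \<beta>) (T \<theta> j)"
  unfolding T_eq by (rule C2_on_add[OF C2_S C2_on_const])

lemma inj_T: "inj_on (T \<theta> j) (Omega_r \<gamma> L \<beta>)"
proof (rule inj_onI)
  fix u v assume "u \<in> Omega_r \<gamma> L \<beta>" "v \<in> Omega_r \<gamma> L \<beta>" "T \<theta> j u = T \<theta> j v"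
  then have "sqrt \<sigma> * dist u v \<le> 0" using expand_T[of u v \<theta> j] by simp
  then show "u = v" using \<sigma> by (simp add: mult_le_0_iff)
qed

lemma continuous_T: "continuous_on (Omega_r \<gamma> L \<beta>) (T \<theta> j)"
  by (rule C2_on_imp_continuous_on[OF C2_T])

lemma continuous_Phi: "continuous_on (Omega_r \<gamma> L \<beta>) (\<lambda>u. \<Phi>0 (Gam \<gamma> u))"
  by (rule continuous_on_compose2[OF C2_on_imp_continuous_on[OF C2Phi]])
     (auto simp: Omega_r_def linear_continuous_on linear_conv_bounded_linear[symmetric] Gam_linear)

lemma \<epsilon>m_pos: "\<epsilon>m > 0"
  using \<gamma> \<beta> by (simp add: \<epsilon>m_def)

lemma half_subset: "Omega \<gamma> (L + \<beta> / 2) \<subseteq> Omega_r \<gamma> L \<beta>" "Omega_r \<gamma> L (\<beta> / 2) \<subseteq> Omega_r \<gamma> L \<beta>"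
    "Omega \<gamma> L \<subseteq> Omega_r \<gamma> L \<beta>"
  using Omega_subset_Omega_r[of \<gamma> "L + \<beta> / 2" L \<beta>] Omega_r_subset_Omega[of \<gamma> L "\<beta> / 2"]
    Omega_subset_Omega_r[of \<gamma> L L \<beta>] \<gamma> \<beta> by auto

lemma cball_subset:
  fixes x :: "(real, 'n) vec"
  assumes x: "x \<in> Omega_r \<gamma> L 0"
  shows "cball x \<epsilon>m \<subseteq> Omega_r \<gamma> L (\<beta> / 2)"
proof
  fix y assume "y \<in> cball x \<epsilon>m"
  then have d: "norm (y - x) \<le> \<epsilon>m" by (simp add: dist_norm norm_minus_commute)
  have "\<bar>y $ i\<bar> < (L + \<beta> / 2) * \<gamma> ^ pos i" for i
  proof -
    have "pos i \<le> CARD('n) - 1" using pos_less[of i] by simp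
    then have "\<gamma> ^ (CARD('n) - 1) \<le> \<gamma> ^ pos i" using \<gamma> by (intro power_decreasing) auto
    then have "\<epsilon>m \<le> \<beta> / 4 * \<gamma> ^ pos i" using \<beta> by (simp add: \<epsilon>m_def mult.commute)
    moreover have "\<bar>y $ i - x $ i\<bar> \<le> norm (y - x)" using component_le_norm_cart[of "y - x" i] by simp
    moreover have "\<bar>x $ i\<bar> < L * \<gamma> ^ pos i" using x \<gamma> by (simp add: mem_Omega_r_iff)
    moreover have "\<beta> / 4 * \<gamma> ^ pos i > 0" using \<beta> \<gamma> by simp
    ultimately show ?thesis using d by (simp add: algebra_simps)
  qed
  then show "y \<in> Omega_r \<gamma> L (\<beta> / 2)" using \<gamma> by (simp add: mem_Omega_r_iff)
qed

lemma U_subset: "U \<theta> j \<subseteq> Omega_r \<gamma> L 0" "U \<theta> j \<subseteq> Omega \<gamma> L"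
  using Omega_r_subset_Omega[of \<gamma> L 0] \<gamma> by (auto simp: Uset_def)

lemma V_subset: "V \<theta> j \<subseteq> Omega_r \<gamma> L (\<beta> / 2)" "V \<theta> j \<subseteq> Omega_r \<gamma> L \<beta>"
proof -
  show *: "V \<theta> j \<subseteq> Omega_r \<gamma> L (\<beta> / 2)"
    unfolding Vset_def nbhd_eq_UN_ball
  proof (rule UN_least)
    fix x assume "x \<in> U \<theta> j"
    then have "x \<in> Omega_r \<gamma> L 0" using U_subset(1) by blast
    from cball_subset[OF this] show "ball x \<epsilon>m \<subseteq> Omega_r \<gamma> L (\<beta> / 2)"
      using ball_subset_cball by (rule subset_trans[rotated])
  qed
  show "V \<theta> j \<subseteq> Omega_r \<gamma> L \<beta>" using * half_subset by blast
qed

lemma open_V: "open (V \<theta> j)"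
  by (simp add: Vset_def open_nbhd)

lemma closure_U_subset_V: "closure (U \<theta> j) \<subseteq> V \<theta> j"
  unfolding Vset_def by (rule closure_subset_nbhd[OF \<epsilon>m_pos])

lemma open_U: "open (U \<theta> j)"
proof -
  have sub: "Omega_r \<gamma> L 0 \<subseteq> Omega_r \<gamma> L \<beta>"
    using Omega_r_subset_Omega[of \<gamma> L 0] half_subset \<gamma> by auto
  have "U \<theta> j = Omega_r \<gamma> L 0 \<inter> (\<lambda>u. \<Phi>0 (Gam \<gamma> u)) -` {(2 * of_int j - 1) * L - \<theta> <..< (2 * of_int j + 1) * L - \<theta>}"
    by (auto simp: Uset_def)
  also have "open \<dots>"
    by (rule continuous_open_preimage[OF continuous_on_subset[OF continuous_Phi sub]])
       (use open_Omega_r \<gamma> in auto)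
  finally show ?thesis .
qed

lemma closure_U_subset: "closure (U \<theta> j) \<subseteq> {x \<in> Omega \<gamma> L.
    (2 * of_int j - 1) * L \<le> \<theta> + \<Phi>0 (Gam \<gamma> x) \<and> \<theta> + \<Phi>0 (Gam \<gamma> x) \<le> (2 * of_int j + 1) * L}" (is "_ \<subseteq> ?C")
proof (rule closure_minimal)
  show "U \<theta> j \<subseteq> ?C" using U_subset(2)[of \<theta> j] by (auto simp: Uset_def)
  have "?C = Omega \<gamma> L \<inter> (\<lambda>u. \<Phi>0 (Gam \<gamma> u)) -` {(2 * of_int j - 1) * L - \<theta> .. (2 * of_int j + 1) * L - \<theta>}"
    by auto
  also have "closed \<dots>"
    by (rule continuous_closed_preimage[OF continuous_on_subset[OF continuous_Phi half_subset(3)]])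
       (use compact_imp_closed[OF compact_Omega(1)[OF \<gamma>(1)]] in auto)
  finally show "closed ?C" .
qed

text \<open>Since U is open, a frontier point lies in the closure but violates one of the strict
  inequalities defining U: those of the box yield a face, those on \<Phi>0 yield a level.\<close>

lemma frontier_U:
  assumes "q \<in> frontier (U \<theta> j)"
  shows "q \<in> Omega \<gamma> L"
    and "(2 * of_int j - 1) * L \<le> \<theta> + \<Phi>0 (Gam \<gamma> q)" "\<theta> + \<Phi>0 (Gam \<gamma> q) \<le> (2 * of_int j + 1) * L"
    and "(\<exists>i. \<bar>q $ i\<bar> = L * \<gamma> ^ pos i) \<or> (\<exists>m::int. \<theta> + \<Phi>0 (Gam \<gamma> q) = (2 * of_int m - 1) * L)"
proof -
  have q: "q \<in> closure (U \<theta> j)" "q \<notin> U \<theta> j"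
    using assms open_U[of \<theta> j] by (auto simp: frontier_def interior_open)
  then show 1: "q \<in> Omega \<gamma> L"
    and 2: "(2 * of_int j - 1) * L \<le> \<theta> + \<Phi>0 (Gam \<gamma> q)" "\<theta> + \<Phi>0 (Gam \<gamma> q) \<le> (2 * of_int j + 1) * L"
    using closure_U_subset by auto
  show "(\<exists>i. \<bar>q $ i\<bar> = L * \<gamma> ^ pos i) \<or> (\<exists>m::int. \<theta> + \<Phi>0 (Gam \<gamma> q) = (2 * of_int m - 1) * L)"
  proof (rule ccontr)
    assume *: "\<not> ?thesis"
    then have "\<bar>q $ i\<bar> < L * \<gamma> ^ pos i" for i
      using 1 \<gamma> by (auto simp: mem_Omega_iff less_le)
    then have "q \<in> Omega_r \<gamma> L 0" using \<gamma> by (simp add: mem_Omega_r_iff)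
    \<comment> \<open>The upper level of branch j is the lower level of branch j + 1, so every level
      has the form (2 m - 1) * L.\<close>
    moreover have "\<theta> + \<Phi>0 (Gam \<gamma> q) \<noteq> (2 * of_int j - 1) * L" "\<theta> + \<Phi>0 (Gam \<gamma> q) \<noteq> (2 * of_int (j + 1) - 1) * L"
      using * by blast+
    ultimately show False using q(2) 2 by (auto simp: Uset_def algebra_simps)
  qed
qed

lemma U_disjoint: "i \<noteq> j \<Longrightarrow> U \<theta> i \<inter> U \<theta> j = {}"
proof (rule ccontr)
  assume "i \<noteq> j" "U \<theta> i \<inter> U \<theta> j \<noteq> {}"
  then obtain x where x: "x \<in> U \<theta> i" "x \<in> U \<theta> j" by blast
  have "(2 * of_int i - 1) * L < (2 * of_int j + 1) * L" "(2 * of_int j - 1) * L < (2 * of_int i + 1) * L"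
    using x by (auto simp: Uset_def)
  then have "2 * real_of_int i - 1 < 2 * of_int j + 1" "2 * real_of_int j - 1 < 2 * of_int i + 1"
    using L by (simp_all add: mult_less_cancel_right)
  then show False using \<open>i \<noteq> j\<close> by linarith
qed

lemma finite_J: "finite (J \<theta>)"
proof -
  have "compact ((\<lambda>u. \<Phi>0 (Gam \<gamma> u)) ` Omega \<gamma> L)"
    using continuous_on_subset[OF continuous_Phi half_subset(3)] compact_Omega \<gamma>
    by (intro compact_continuous_image) auto
  then obtain B where B: "\<And>u. u \<in> Omega \<gamma> L \<Longrightarrow> \<bar>\<Phi>0 (Gam \<gamma> u)\<bar> \<le> B"
    using compact_imp_bounded[of "(\<lambda>u. \<Phi>0 (Gam \<gamma> u)) ` Omega \<gamma> L"] by (auto simp: bounded_iff)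
  \<comment> \<open>This bounds |\<theta> + \<Phi>0| on \<Omega> in units of L, and a nonempty U_j
    forces |j| to be of that order.\<close>
  define M where "M = (\<bar>\<theta>\<bar> + B) / L"
  have "J \<theta> \<subseteq> {- (\<lceil>M\<rceil> + 1)..\<lceil>M\<rceil> + 1}"
  proof
    fix j assume "j \<in> J \<theta>"
    then obtain u where u: "u \<in> U \<theta> j" by (auto simp: Jset_def)
    then have "\<bar>\<Phi>0 (Gam \<gamma> u)\<bar> \<le> B" using B U_subset(2) by blast
    then have "\<bar>\<theta> + \<Phi>0 (Gam \<gamma> u)\<bar> \<le> M * L" using L by (simp add: M_def)
    moreover have "(2 * of_int j - 1) * L < \<theta> + \<Phi>0 (Gam \<gamma> u)" "\<theta> + \<Phi>0 (Gam \<gamma> u) < (2 * of_int j + 1) * L"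
      using u by (auto simp: Uset_def)
    ultimately have "(2 * of_int j - 1) * L < M * L" "(- M) * L < (2 * of_int j + 1) * L" by auto
    then have "2 * real_of_int j - 1 < M" "- M < 2 * real_of_int j + 1"
      using mult_less_cancel_right_pos[OF L] by blast+
    moreover have "M \<ge> 0" using \<open>\<bar>\<theta> + \<Phi>0 (Gam \<gamma> u)\<bar> \<le> M * L\<close> L by (smt (verit) mult_neg_pos)
    ultimately have "real_of_int j \<le> of_int (\<lceil>M\<rceil> + 1)" "real_of_int (- (\<lceil>M\<rceil> + 1)) \<le> of_int j"
      using le_of_int_ceiling[of M] by linarith+
    then show "j \<in> {- (\<lceil>M\<rceil> + 1)..\<lceil>M\<rceil> + 1}" unfolding of_int_le_iff by simp
  qed
  then show ?thesis by (rule finite_subset) simp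
qed

lemma Ttheta_eq_T: "u \<in> U \<theta> j \<Longrightarrow> Ttheta \<gamma> L \<Phi>0 \<theta> u = T \<theta> j u"
proof -
  assume u: "u \<in> U \<theta> j"
  have "\<lfloor>(\<Phi>0 (Gam \<gamma> u) + \<theta> + L) / (2 * L)\<rfloor> = j"
  proof (rule floor_unique)
    show "of_int j \<le> (\<Phi>0 (Gam \<gamma> u) + \<theta> + L) / (2 * L)"
      using u L by (simp add: Uset_def pos_le_divide_eq algebra_simps)
    show "(\<Phi>0 (Gam \<gamma> u) + \<theta> + L) / (2 * L) < of_int j + 1"
      using u L by (simp add: Uset_def pos_divide_less_eq algebra_simps)
  qed
  moreover have "pos i + 1 < CARD('n) \<longleftrightarrow> pos i + 1 \<noteq> CARD('n)" for i :: 'n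
    using pos_less[of i] by auto
  ultimately show ?thesis
    unfolding Ttheta_def Tj_def Smap_def phi_red_def by (simp add: vec_eq_iff algebra_simps)
qed

text \<open>The sphere of radius \<open>\<epsilon>m\<close> about u is sent to distance at least
  sqrt \<sigma> * \<epsilon>m from the image of u, and the image of the ball is open by invariance
  of domain; hence it contains the whole ball of that radius. The radius serves as r0.\<close>

lemma nbhd_image_subset: "nbhd (sqrt \<sigma> * \<epsilon>m) (T \<theta> j ` U \<theta> j) \<subseteq> T \<theta> j ` V \<theta> j"
proof -
  have "ball (T \<theta> j u) (sqrt \<sigma> * \<epsilon>m) \<subseteq> T \<theta> j ` V \<theta> j" if u: "u \<in> U \<theta> j" for u
  proof -
    have sub: "cball u \<epsilon>m \<subseteq> Omega_r \<gamma> L \<beta>"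
      using cball_subset[of u] U_subset(1)[of \<theta> j] u half_subset(2) by auto
    have "ball (T \<theta> j u) (sqrt \<sigma> * \<epsilon>m) \<subseteq> T \<theta> j ` ball u \<epsilon>m"
    proof (rule ball_subset_open_map_image)
      show "continuous_on (closure (ball u \<epsilon>m)) (T \<theta> j)"
        using continuous_on_subset[OF continuous_T sub] \<epsilon>m_pos by simp
      show "open (T \<theta> j ` interior (ball u \<epsilon>m))"
        unfolding interior_open[OF open_ball] using sub ball_subset_cball[of u \<epsilon>m]
        by (intro invariance_of_domain continuous_on_subset[OF continuous_T] inj_on_subset[OF inj_T]) auto
      show "sqrt \<sigma> * \<epsilon>m \<le> norm (T \<theta> j z - T \<theta> j u)" if "z \<in> frontier (ball u \<epsilon>m)" for z
      proof -
        have z: "dist u z = \<epsilon>m" using that \<epsilon>m_pos by (simp add: frontier_ball)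
        then have "z \<in> Omega_r \<gamma> L \<beta>" "u \<in> Omega_r \<gamma> L \<beta>" using sub \<epsilon>m_pos by auto
        then show ?thesis using expand_T[of z u \<theta> j] z by (simp add: dist_norm norm_minus_commute)
      qed
    qed (use \<epsilon>m_pos \<sigma> in auto)
    also have "\<dots> \<subseteq> T \<theta> j ` V \<theta> j" using u by (auto simp: Vset_def nbhd_eq_UN_ball)
    finally show ?thesis .
  qed
  then show ?thesis by (auto simp: nbhd_eq_UN_ball)
qed

lemma C2_diffeo_T: "C2_diffeo_on (V \<theta> j) (T \<theta> j)"
proof (rule C2_diffeo_on_expanding[OF open_V _ C2_on_subset[OF C2_T V_subset(2)]])
  show "sqrt \<sigma> > 0" using \<sigma> by simp
  show "sqrt \<sigma> * dist x y \<le> dist (T \<theta> j x) (T \<theta> j y)" if "x \<in> V \<theta> j" "y \<in> V \<theta> j" for x y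
    using that V_subset(2)[of \<theta> j] by (intro expand_T) auto
qed

lemma inv_T_contract:
  assumes "u \<in> T \<theta> j ` V \<theta> j" "v \<in> T \<theta> j ` V \<theta> j"
  shows "dist (inv_into (V \<theta> j) (T \<theta> j) u) (inv_into (V \<theta> j) (T \<theta> j) v) \<le> \<sigma> powr (-1/2) * dist u v"
proof -
  let ?g = "inv_into (V \<theta> j) (T \<theta> j)"
  have "?g u \<in> Omega_r \<gamma> L \<beta>" "?g v \<in> Omega_r \<gamma> L \<beta>"
    using subsetD[OF V_subset(2) inv_into_into] assms by simp_all
  from expand_T[OF this, of \<theta> j] have "sqrt \<sigma> * dist (?g u) (?g v) \<le> dist u v"
    using assms by (simp add: f_inv_into_f)
  then have "dist (?g u) (?g v) \<le> 1 / sqrt \<sigma> * dist u v"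
    using \<sigma> by (simp add: pos_le_divide_eq mult.commute)
  then show ?thesis using powr_minus_half[of \<sigma>] \<sigma> by simp
qed

end

section \<open>Jacobian distortion\<close>

text \<open>Factors are exchanged one at a time; M is at least 1 so that a single power of M bounds
  all partial products.\<close>

lemma abs_prod_diff_le:
  fixes a b :: "'i \<Rightarrow> real"
  assumes "finite I" "M \<ge> 1" "d \<ge> 0"
    and "\<And>i. i \<in> I \<Longrightarrow> \<bar>a i\<bar> \<le> M" "\<And>i. i \<in> I \<Longrightarrow> \<bar>b i\<bar> \<le> M" "\<And>i. i \<in> I \<Longrightarrow> \<bar>a i - b i\<bar> \<le> d"
  shows "\<bar>prod a I - prod b I\<bar> \<le> real (card I) * M ^ card I * d"
  using assms(1,4-)
proof (induction I rule: finite_induct)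
  case (insert x I)
  have M: "M ^ card I \<le> M ^ Suc (card I)" using assms(2) by (intro power_increasing) auto
  have pa: "\<bar>prod a I\<bar> \<le> M ^ card I"
    unfolding abs_prod using insert assms(2) by (intro prod_le_power) auto
  have "prod a (insert x I) - prod b (insert x I) = (a x - b x) * prod a I + b x * (prod a I - prod b I)"
    using insert by (simp add: algebra_simps)
  then have "\<bar>prod a (insert x I) - prod b (insert x I)\<bar> \<le> \<bar>a x - b x\<bar> * \<bar>prod a I\<bar> + \<bar>b x\<bar> * \<bar>prod a I - prod b I\<bar>"
    by (metis abs_mult abs_triangle_ineq)
  also have "\<dots> \<le> d * M ^ card I + M * (real (card I) * M ^ card I * d)"
    using insert pa assms by (intro add_mono mult_mono) auto
  also have "\<dots> \<le> d * M ^ Suc (card I) + M * (real (card I) * M ^ card I * d)"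
    using M assms by (intro add_mono mult_left_mono) auto
  finally show ?case using insert by (simp add: algebra_simps)
qed simp

text \<open>The permutation expansion has k! terms, each a signed product covered by
  \<open>abs_prod_diff_le\<close>.\<close>

lemma abs_det_diff_le:
  fixes A B :: "real^'n^'n"
  assumes "M \<ge> 1" "d \<ge> 0"
    and "\<And>i j. \<bar>A $ i $ j\<bar> \<le> M" "\<And>i j. \<bar>B $ i $ j\<bar> \<le> M" "\<And>i j. \<bar>A $ i $ j - B $ i $ j\<bar> \<le> d"
  shows "\<bar>det A - det B\<bar> \<le> fact CARD('n) * (real CARD('n) * M ^ CARD('n) * d)"
proof -
  let ?P = "{p :: 'n \<Rightarrow> 'n. p permutes UNIV}"
  have "\<bar>det A - det B\<bar> = \<bar>\<Sum>p\<in>?P. of_int (sign p) * ((\<Prod>i\<in>UNIV. A $ i $ p i) - (\<Prod>i\<in>UNIV. B $ i $ p i))\<bar>"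
    by (simp add: det_def right_diff_distrib sum_subtractf)
  also have "\<dots> \<le> (\<Sum>p\<in>?P. \<bar>of_int (sign p) * ((\<Prod>i\<in>UNIV. A $ i $ p i) - (\<Prod>i\<in>UNIV. B $ i $ p i))\<bar>)"
    by (rule sum_abs)
  also have "\<dots> \<le> (\<Sum>p\<in>?P. real CARD('n) * M ^ CARD('n) * d)"
  proof (rule sum_mono)
    fix p
    have "\<bar>(\<Prod>i\<in>UNIV. A $ i $ p i) - (\<Prod>i\<in>UNIV. B $ i $ p i)\<bar> \<le> real CARD('n) * M ^ CARD('n) * d"
      using assms by (intro abs_prod_diff_le) auto
    then show "\<bar>of_int (sign p) * ((\<Prod>i\<in>UNIV. A $ i $ p i) - (\<Prod>i\<in>UNIV. B $ i $ p i))\<bar>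
        \<le> real CARD('n) * M ^ CARD('n) * d"
      by (simp add: abs_mult sign_def)
  qed
  also have "\<dots> = fact CARD('n) * (real CARD('n) * M ^ CARD('n) * d)"
    by (simp add: card_permutations[of UNIV "CARD('n)"])
  finally show ?thesis .
qed

lemma abs_det_le:
  fixes A :: "real^'n^'n"
  assumes "M \<ge> 0" "\<And>i j. \<bar>A $ i $ j\<bar> \<le> M"
  shows "\<bar>det A\<bar> \<le> fact CARD('n) * M ^ CARD('n)"
proof -
  let ?P = "{p :: 'n \<Rightarrow> 'n. p permutes UNIV}"
  have "\<bar>det A\<bar> \<le> (\<Sum>p\<in>?P. \<bar>of_int (sign p) * (\<Prod>i\<in>UNIV. A $ i $ p i)\<bar>)"
    unfolding det_def by (rule sum_abs)
  also have "\<dots> \<le> (\<Sum>p\<in>?P. M ^ CARD('n))"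
  proof (rule sum_mono)
    fix p
    have "(\<Prod>i\<in>UNIV. \<bar>A $ i $ p i\<bar>) \<le> (\<Prod>i\<in>(UNIV::'n set). M)"
      using assms by (intro prod_mono) auto
    then show "\<bar>of_int (sign p) * (\<Prod>i\<in>UNIV. A $ i $ p i)\<bar> \<le> M ^ CARD('n)"
      by (simp add: abs_mult sign_def abs_prod)
  qed
  also have "\<dots> = fact CARD('n) * M ^ CARD('n)"
    by (simp add: card_permutations[of UNIV "CARD('n)"])
  finally show ?thesis .
qed

lemma abs_matrix_blinfun_le:
  fixes f :: "(real^'m) \<Rightarrow>\<^sub>L (real^'n)"
  shows "\<bar>matrix (blinfun_apply f) $ i $ j\<bar> \<le> norm f"
proof -
  have "\<bar>matrix (blinfun_apply f) $ i $ j\<bar> = \<bar>blinfun_apply f (axis j 1) $ i\<bar>"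
    by (simp add: matrix_def)
  also have "\<dots> \<le> norm (blinfun_apply f (axis j 1))" by (rule component_le_norm_cart)
  also have "\<dots> \<le> norm f" using norm_blinfun[of f "axis j 1"] by simp
  finally show ?thesis .
qed

text \<open>The second derivative is bounded on K by compactness, and convexity lets the mean value
  inequality turn this into a Lipschitz bound for f'. One constant serves both purposes, taken at
  least 1 to meet the hypothesis of \<open>abs_det_diff_le\<close>.\<close>

lemma C2_on_bounds_on_compact:
  assumes f: "C2_on S f" and K: "compact K" "convex K" "K \<subseteq> S"
  shows "\<exists>f' B. (\<forall>x\<in>S. (f has_derivative blinfun_apply (f' x)) (at x)) \<and> B \<ge> 1 \<and>
    (\<forall>x\<in>K. norm (f' x) \<le> B) \<and> (\<forall>x\<in>K. \<forall>y\<in>K. norm (f' x - f' y) \<le> B * norm (x - y))"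
proof -
  obtain f' f'' where f': "\<And>x. x \<in> S \<Longrightarrow> (f has_derivative blinfun_apply (f' x)) (at x)"
    and f'': "\<And>x. x \<in> S \<Longrightarrow> (f' has_derivative blinfun_apply (f'' x)) (at x)" and c: "continuous_on S f''"
    using f unfolding C2_on_def by metis
  have c': "continuous_on K f'"
    using f'' K by (meson continuous_at_imp_continuous_on has_derivative_continuous subsetD)
  obtain B1 where B1: "\<And>x. x \<in> K \<Longrightarrow> norm (f' x) \<le> B1"
    using compact_imp_bounded[OF compact_continuous_image[OF c' K(1)]] by (auto simp: bounded_iff)
  obtain B2 where B2: "\<And>x. x \<in> K \<Longrightarrow> norm (f'' x) \<le> B2"
    using compact_imp_bounded[OF compact_continuous_image[OF continuous_on_subset[OF c K(3)] K(1)]]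
    by (auto simp: bounded_iff)
  define B where "B = max 1 (max B1 B2)"
  have L: "norm (f' x - f' y) \<le> B * norm (x - y)" if "x \<in> K" "y \<in> K" for x y
  proof (rule differentiable_bound[OF K(2)])
    fix z assume z: "z \<in> K"
    show "(f' has_derivative blinfun_apply (f'' z)) (at z within K)"
      using f'' z K(3) has_derivative_at_withinI by blast
    show "onorm (blinfun_apply (f'' z)) \<le> B"
      using B2[OF z] by (simp add: norm_blinfun.rep_eq[symmetric] B_def)
  qed (use that in auto)
  show ?thesis
    using f' L B1 by (intro exI[of _ f'] exI[of _ B]) (force simp: B_def)
qed

lemma det_matrix_inverse_mult:
  fixes f g :: "(real^'n) \<Rightarrow>\<^sub>L (real^'n)"
  assumes "f o\<^sub>L g = id_blinfun"
  shows "det (matrix (blinfun_apply f)) * det (matrix (blinfun_apply g)) = 1"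
proof -
  have lin: "linear (blinfun_apply f)" "linear (blinfun_apply g)"
    by (simp_all add: blinfun.bounded_linear_right bounded_linear.linear)
  have fg: "blinfun_apply f \<circ> blinfun_apply g = id"
    using arg_cong[OF assms, of blinfun_apply] by (simp add: blinfun_compose.rep_eq id_def)
  have "matrix (blinfun_apply f) ** matrix (blinfun_apply g) = mat 1"
    unfolding matrix_compose[OF lin(2,1), symmetric] fg matrix_id_mat_1 ..
  then show ?thesis by (metis det_I det_mul)
qed

context expanding_family begin

text \<open>Let n and m be the determinants of the inverse derivative and of the derivative. As n m
  = 1, n x - n y = n x n y (m y - m x), and m is Lipschitz because S' is Lipschitz on a compact box.
  The factor |n z| is inserted at the end through 1 \<le> |n z| * D, where D bounds |m|.\<close>

lemma jacobian_distortion: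
  obtains K where "K > 0" and
    "\<And>\<theta> j \<epsilon> x y z. x \<in> T \<theta> j ` V \<theta> j \<Longrightarrow> y \<in> T \<theta> j ` V \<theta> j \<Longrightarrow> z \<in> T \<theta> j ` V \<theta> j \<Longrightarrow>
      dist z x < \<epsilon> \<Longrightarrow> dist z y < \<epsilon> \<Longrightarrow>
      \<bar>jac_det (inv_into (V \<theta> j) (T \<theta> j)) x - jac_det (inv_into (V \<theta> j) (T \<theta> j)) y\<bar>
        \<le> K * \<bar>jac_det (inv_into (V \<theta> j) (T \<theta> j)) z\<bar> * \<epsilon>"
proof -
  let ?C = "Omega \<gamma> (L + \<beta> / 2) :: ((real, 'n) vec) set"
  obtain S' B where S'_B: "\<forall>x\<in>Omega_r \<gamma> L \<beta>. (S has_derivative blinfun_apply (S' x)) (at x)" "B \<ge> 1"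
    "\<forall>x\<in>?C. norm (S' x) \<le> B" "\<forall>x\<in>?C. \<forall>y\<in>?C. norm (S' x - S' y) \<le> B * norm (x - y)"
    using C2_on_bounds_on_compact[OF C2_S compact_Omega[OF \<gamma>(1)] half_subset(1)] by (elim exE conjE)
  note B = S'_B(2) and S' = bspec[OF S'_B(1)] and S'B = bspec[OF S'_B(3)]
    and S'L = bspec[OF bspec[OF S'_B(4)]]
  define F :: real where "F = fact CARD('n)"
  define Q where "Q = F * (real CARD('n) * B ^ CARD('n) * B)"
  define D where "D = F * B ^ CARD('n)"
  have F: "F > 0" by (simp add: F_def)
  have Q: "Q > 0" and D: "D > 0" using B F k2 by (auto simp: Q_def D_def intro!: mult_pos_pos)
  show ?thesis
  \<comment> \<open>F * F bounds the two inverse determinants, Q is the Lipschitz constant of det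
    S', the 2 comes from dist y x \<le> 2 * \<epsilon>, and D from the comparison with z.\<close>
  proof (rule that[of "F * F * (Q * 2) * D"])
    show "F * F * (Q * 2) * D > 0" using F Q D by simp
    fix \<theta> j \<epsilon> x y z
    assume xyz: "x \<in> T \<theta> j ` V \<theta> j" "y \<in> T \<theta> j ` V \<theta> j" "z \<in> T \<theta> j ` V \<theta> j"
      and d: "dist z x < \<epsilon>" "dist z y < \<epsilon>"
    let ?g = "inv_into (V \<theta> j) (T \<theta> j)"
    have T': "(T \<theta> j has_derivative blinfun_apply (S' v)) (at v)" if "v \<in> V \<theta> j" for v
      unfolding T_eq using has_derivative_add[OF S' has_derivative_const] subsetD[OF V_subset(2) that] by simp
    have sq: "sqrt \<sigma> > 0" using \<sigma> by simp
    have ex: "sqrt \<sigma> * dist u v \<le> dist (T \<theta> j u) (T \<theta> j v)" if "u \<in> V \<theta> j" "v \<in> V \<theta> j" for u v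
      using that V_subset(2)[of \<theta> j] by (intro expand_T) auto
    obtain N where N_all: "\<forall>w\<in>T \<theta> j ` V \<theta> j. (?g has_derivative blinfun_apply (N w)) (at w) \<and>
        N w o\<^sub>L S' (?g w) = id_blinfun \<and> S' (?g w) o\<^sub>L N w = id_blinfun \<and> norm (N w) \<le> 1 / sqrt \<sigma>"
      using expanding_inverse_has_derivative(3)[of "V \<theta> j" "sqrt \<sigma>" "T \<theta> j" S', OF open_V sq] ex T'
      by (elim meta_impE exE) auto
    have N: "(?g has_derivative blinfun_apply (N w)) (at w)" and NM: "N w o\<^sub>L S' (?g w) = id_blinfun"
      and Nb: "norm (N w) \<le> 1 / sqrt \<sigma>" if "w \<in> T \<theta> j ` V \<theta> j" for w
      using bspec[OF N_all that] by simp_all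
    define n where "n w = det (matrix (blinfun_apply (N w)))" for w
    define m where "m w = det (matrix (blinfun_apply (S' (?g w))))" for w
    have jac: "jac_det ?g w = n w" if "w \<in> T \<theta> j ` V \<theta> j" for w
      using frechet_derivative_at[OF N[OF that]] by (simp add: jac_det_def n_def)
    have nm: "n w * m w = 1" if "w \<in> T \<theta> j ` V \<theta> j" for w
      unfolding n_def m_def by (rule det_matrix_inverse_mult[OF NM[OF that]])
    have gC: "?g w \<in> ?C" if "w \<in> T \<theta> j ` V \<theta> j" for w
      using inv_into_into[OF that] V_subset(1)[of \<theta> j] Omega_r_subset_Omega[OF \<gamma>(1), of L "\<beta> / 2"] by blast
    have n1: "\<bar>n w\<bar> \<le> F" if "w \<in> T \<theta> j ` V \<theta> j" for w
    proof -
      have "norm (N w) \<le> 1" using Nb[OF that] \<sigma> by (simp add: order_trans)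
      then show ?thesis
        using abs_det_le[of 1 "matrix (blinfun_apply (N w))"] abs_matrix_blinfun_le[of "N w"]
        by (auto simp: n_def F_def intro: order_trans)
    qed
    have m1: "\<bar>m w\<bar> \<le> D" if "w \<in> T \<theta> j ` V \<theta> j" for w
      unfolding m_def D_def F_def using B
      by (intro abs_det_le order_trans[OF abs_matrix_blinfun_le S'B[OF gC[OF that]]]) auto
    have mL: "\<bar>m y - m x\<bar> \<le> Q * dist (?g y) (?g x)"
    proof -
      have "\<bar>m y - m x\<bar> \<le> F * (real CARD('n) * B ^ CARD('n) * (B * dist (?g y) (?g x)))"
        unfolding m_def F_def
      proof (rule abs_det_diff_le[OF B])
        fix i l :: 'n
        have "\<bar>matrix (blinfun_apply (S' (?g y))) $ i $ l - matrix (blinfun_apply (S' (?g x))) $ i $ l\<bar>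
            = \<bar>matrix (blinfun_apply (S' (?g y) - S' (?g x))) $ i $ l\<bar>"
          by (simp add: matrix_def minus_blinfun.rep_eq)
        also have "\<dots> \<le> norm (S' (?g y) - S' (?g x))" by (rule abs_matrix_blinfun_le)
        also have "\<dots> \<le> B * dist (?g y) (?g x)"
          using S'L[OF gC gC] xyz by (simp add: dist_norm)
        finally show "\<bar>matrix (blinfun_apply (S' (?g y))) $ i $ l - matrix (blinfun_apply (S' (?g x))) $ i $ l\<bar>
            \<le> B * dist (?g y) (?g x)" .
      qed (use B order_trans[OF abs_matrix_blinfun_le S'B[OF gC]] xyz in auto)
      then show ?thesis by (simp add: Q_def mult_ac)
    qed
    have "\<sigma> powr (-1/2) \<le> 1" using \<sigma> powr_minus_half[of \<sigma>] by simp
    then have "dist (?g y) (?g x) \<le> dist y x"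
      using inv_T_contract[OF xyz(2,1)] mult_right_mono[of "\<sigma> powr (-1/2)" 1 "dist y x"] by simp
    also have "\<dots> \<le> 2 * \<epsilon>" using d dist_triangle3[of y x z] by simp
    finally have "\<bar>m y - m x\<bar> \<le> Q * (2 * \<epsilon>)" using mL Q by (meson mult_left_mono less_imp_le order_trans)
    moreover have "n x - n y = n x * n y * (m y - m x)"
    proof -
      have "n x * n y * (m y - m x) = n x * (n y * m y) - n y * (n x * m x)" by (simp add: algebra_simps)
      then show ?thesis using nm[OF xyz(1)] nm[OF xyz(2)] by simp
    qed
    moreover have "\<bar>n x * n y\<bar> \<le> F * F" using n1 xyz F by (simp add: abs_mult mult_mono)
    ultimately have "\<bar>n x - n y\<bar> \<le> F * F * (Q * (2 * \<epsilon>))"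
      using F by (simp only: abs_mult[of "n x * n y"]) (intro mult_mono, auto)
    also have "\<dots> = F * F * (Q * 2) * \<epsilon> * 1" by simp
    also have "\<dots> \<le> F * F * (Q * 2) * \<epsilon> * (\<bar>n z\<bar> * D)"
    proof (rule mult_left_mono)
      have "1 = \<bar>n z\<bar> * \<bar>m z\<bar>" using nm[OF xyz(3)] by (simp add: abs_mult[symmetric])
      also have "\<dots> \<le> \<bar>n z\<bar> * D" using m1[OF xyz(3)] by (rule mult_left_mono) simp
      finally show "1 \<le> \<bar>n z\<bar> * D" .
      have "\<epsilon> > 0" using d(1) zero_le_dist[of z x] by linarith
      then show "0 \<le> F * F * (Q * 2) * \<epsilon>" using F Q by simp
    qed
    finally show "\<bar>jac_det ?g x - jac_det ?g y\<bar> \<le> F * F * (Q * 2) * D * \<bar>jac_det ?g z\<bar> * \<epsilon>"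
      using xyz by (simp add: jac mult_ac)
  qed
qed

end

section \<open>Discontinuity levels\<close>

lemma negligible_coordinate_hyperplane: "negligible {x :: real^'n. x $ i = c}"
proof -
  have "axis i 1 \<noteq> (0 :: real^'n)" by (simp add: axis_eq_0_iff)
  then show ?thesis using negligible_hyperplane[of "axis i 1 :: real^'n" c] by (simp add: inner_axis')
qed

context expanding_family begin

lemma S_last: "S u $ crd (CARD('n) - 1) = \<gamma> ^ (CARD('n) - 1) * \<Phi>0 (Gam \<gamma> u)"
  using k2 by (simp add: Smap_def pos_crd)

text \<open>S carries the level into a coordinate hyperplane, which is null, and expansion makes the
  inverse of S Lipschitz; Lipschitz images of null sets are null.\<close>

lemma negligible_level: "negligible {x \<in> Omega \<gamma> L. \<Phi>0 (Gam \<gamma> x) = c}" (is "negligible ?A")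
proof -
  let ?R = "Omega_r \<gamma> L \<beta> :: (real, 'n) vec set"
  have inj: "inj_on S ?R" using inj_T[of 0 0] by (auto simp: T_eq inj_on_def)
  have A: "?A \<subseteq> ?R" using half_subset(3) by blast
  have neg: "negligible (S ` ?A)"
  proof (rule negligible_subset)
    show "negligible {y :: (real, 'n) vec. y $ crd (CARD('n) - 1) = \<gamma> ^ (CARD('n) - 1) * c}"
      by (rule negligible_coordinate_hyperplane)
    show "S ` ?A \<subseteq> {y. y $ crd (CARD('n) - 1) = \<gamma> ^ (CARD('n) - 1) * c}"
      by (auto simp: S_last simp del: One_nat_def)
  qed
  have "negligible (inv_into ?R S ` (S ` ?A))"
  proof (rule negligible_locally_Lipschitz_image[OF _ neg])
    fix x assume x: "x \<in> S ` ?A"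
    have "norm (inv_into ?R S y - inv_into ?R S x) \<le> 1 / sqrt \<sigma> * norm (y - x)" if y: "y \<in> S ` ?A" for y
    proof -
      obtain u where "u \<in> ?A" "x = S u" using x by (elim imageE)
      moreover obtain v where "v \<in> ?A" "y = S v" using y by (elim imageE)
      ultimately have uv: "u \<in> ?R" "v \<in> ?R" "x = S u" "y = S v" using A by auto
      then show ?thesis
        using expand[OF uv(2,1)] inj \<sigma> by (simp add: inv_into_f_f dist_norm pos_le_divide_eq mult.commute)
    qed
    then show "\<exists>W B. open W \<and> x \<in> W \<and> (\<forall>y\<in>S ` ?A \<inter> W. norm (inv_into ?R S y - inv_into ?R S x) \<le> B * norm (y - x))"
      by (intro exI[of _ UNIV] exI[of _ "1 / sqrt \<sigma>"]) auto
  qed simp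
  moreover have "inv_into ?R S ` (S ` ?A) = ?A" by (rule inv_into_image_cancel[OF inj A])
  ultimately show ?thesis by simp
qed

lemma U_cover: "emeasure lebesgue (Omega \<gamma> L - (\<Union>j\<in>J \<theta>. U \<theta> j)) = 0"
proof -
  let ?level = "\<lambda>m::int. {x \<in> Omega \<gamma> L. \<Phi>0 (Gam \<gamma> x) = (2 * of_int m - 1) * L - \<theta>}"
  let ?face = "\<lambda>i. {x :: (real, 'n) vec. x $ i = L * \<gamma> ^ pos i} \<union> {x. x $ i = - (L * \<gamma> ^ pos i)}"
  have "negligible ((\<Union>i\<in>UNIV. ?face i) \<union> (\<Union>m\<in>UNIV. ?level m))"
    by (intro negligible_Un negligible_countable_Union)
       (auto intro!: negligible_Un negligible_coordinate_hyperplane negligible_level)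
  moreover have "Omega \<gamma> L - (\<Union>j\<in>J \<theta>. U \<theta> j) \<subseteq> (\<Union>i\<in>UNIV. ?face i) \<union> (\<Union>m\<in>UNIV. ?level m)"
  proof
    fix x assume x: "x \<in> Omega \<gamma> L - (\<Union>j\<in>J \<theta>. U \<theta> j)"
    show "x \<in> (\<Union>i\<in>UNIV. ?face i) \<union> (\<Union>m\<in>UNIV. ?level m)"
    proof (rule ccontr)
      assume nx: "x \<notin> (\<Union>i\<in>UNIV. ?face i) \<union> (\<Union>m\<in>UNIV. ?level m)"
      have "\<bar>x $ i\<bar> < L * \<gamma> ^ pos i" for i
      proof -
        have "\<bar>x $ i\<bar> \<le> L * \<gamma> ^ pos i" using x \<gamma> by (simp add: mem_Omega_iff)
        moreover have "x $ i \<noteq> L * \<gamma> ^ pos i" "x $ i \<noteq> - (L * \<gamma> ^ pos i)" using nx by auto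
        ultimately show ?thesis by linarith
      qed
      then have x0: "x \<in> Omega_r \<gamma> L 0" using \<gamma> by (simp add: mem_Omega_r_iff)
      define t where "t = \<theta> + \<Phi>0 (Gam \<gamma> x)"
      define j where "j = \<lfloor>(t + L) / (2 * L)\<rfloor>"
      have "of_int j \<le> (t + L) / (2 * L)" "(t + L) / (2 * L) < of_int j + 1"
        unfolding j_def by linarith+
      then have t: "(2 * of_int j - 1) * L \<le> t" "t < (2 * of_int j + 1) * L"
        using L by (simp_all add: pos_le_divide_eq pos_divide_less_eq algebra_simps)
      moreover have "\<Phi>0 (Gam \<gamma> x) \<noteq> (2 * of_int j - 1) * L - \<theta>" using nx x by simp
      ultimately have "x \<in> U \<theta> j" using x0 by (simp add: Uset_def t_def)
      then show False using x by (auto simp: Jset_def)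
    qed
  qed
  ultimately have "negligible (Omega \<gamma> L - (\<Union>j\<in>J \<theta>. U \<theta> j))" by (rule negligible_subset)
  then show ?thesis unfolding negligible_iff_null_sets by (rule null_setsD1)
qed

text \<open>The closure of U is compact and lies where T is continuous, so its image is closed and
  contains the closure of the image of U. Removing the open image of U leaves only images of
  frontier points.\<close>

lemma frontier_image_T: "frontier (T \<theta> j ` U \<theta> j) \<subseteq> T \<theta> j ` frontier (U \<theta> j)"
proof -
  have cl: "closure (U \<theta> j) \<subseteq> Omega_r \<gamma> L \<beta>" using closure_U_subset[of \<theta> j] half_subset(3) by auto
  have U: "U \<theta> j \<subseteq> Omega_r \<gamma> L \<beta>" by (rule subset_trans[OF closure_subset cl])
  have "open (T \<theta> j ` U \<theta> j)"
    by (rule invariance_of_domain[OF continuous_on_subset[OF continuous_T U] open_U inj_on_subset[OF inj_T U]])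
  then have "frontier (T \<theta> j ` U \<theta> j) = closure (T \<theta> j ` U \<theta> j) - T \<theta> j ` U \<theta> j"
    by (simp add: frontier_def interior_open)
  moreover have "closure (T \<theta> j ` U \<theta> j) \<subseteq> T \<theta> j ` closure (U \<theta> j)"
  proof (rule closure_minimal)
    have "bounded (U \<theta> j)"
      by (rule bounded_subset[OF compact_imp_bounded[OF compact_Omega(1)[OF \<gamma>(1)]] U_subset(2)])
    then have "compact (T \<theta> j ` closure (U \<theta> j))"
      by (intro compact_continuous_image continuous_on_subset[OF continuous_T cl]) (simp add: compact_closure)
    then show "closed (T \<theta> j ` closure (U \<theta> j))" by (rule compact_imp_closed)
  qed (rule image_mono[OF closure_subset])
  moreover have "frontier (U \<theta> j) = closure (U \<theta> j) - U \<theta> j"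
    using open_U[of \<theta> j] by (simp add: frontier_def interior_open)
  ultimately show ?thesis by (simp only:) blast
qed

text \<open>Expansion bounds S from below; this bound from above limits how much the last coordinate
  varies over a small ball, which prevents a slice from reaching two different levels.\<close>

lemma S_Lipschitz:
  "\<exists>B\<ge>1. \<forall>x\<in>Omega \<gamma> (L + \<beta> / 2). \<forall>y\<in>Omega \<gamma> (L + \<beta> / 2). dist (S x) (S y) \<le> B * dist x y"
proof -
  let ?C = "Omega \<gamma> (L + \<beta> / 2) :: ((real, 'n) vec) set"
  obtain S' B where S'_B: "\<forall>x\<in>Omega_r \<gamma> L \<beta>. (S has_derivative blinfun_apply (S' x)) (at x)" "B \<ge> 1"
    "\<forall>x\<in>?C. norm (S' x) \<le> B" "\<forall>x\<in>?C. \<forall>y\<in>?C. norm (S' x - S' y) \<le> B * norm (x - y)"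
    using C2_on_bounds_on_compact[OF C2_S compact_Omega[OF \<gamma>(1)] half_subset(1)] by (elim exE conjE)
  have "norm (S x - S y) \<le> B * norm (x - y)" if "x \<in> ?C" "y \<in> ?C" for x y
  proof (rule differentiable_bound[OF compact_Omega(2)[OF \<gamma>(1)]])
    fix z assume z: "z \<in> ?C"
    show "(S has_derivative blinfun_apply (S' z)) (at z within ?C)"
      by (rule has_derivative_at_withinI[OF bspec[OF S'_B(1) subsetD[OF half_subset(1) z]]])
    show "onorm (blinfun_apply (S' z)) \<le> B"
      using S'_B(3) z by (simp add: norm_blinfun.rep_eq[symmetric])
  qed (use that in simp_all)
  then show ?thesis using S'_B(2) unfolding dist_norm by (intro exI[of _ B] conjI ballI)
qed

end

section \<open>Multiplicity of boundary neighbourhoods\<close>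

lemma norm_axis: "norm (axis i x :: real^'n) = \<bar>x\<bar>"
proof -
  have "axis i x = x *\<^sub>R (axis i 1 :: real^'n)" by (simp add: vec_eq_iff axis_def)
  then show ?thesis by simp
qed

lemma card_le_2_of_close_ints:
  fixes X :: "int set"
  assumes "\<And>i j. i \<in> X \<Longrightarrow> j \<in> X \<Longrightarrow> i < j \<Longrightarrow> j \<le> i + 1"
  shows "finite X" "card X \<le> 2"
proof -
  have sub: "\<exists>a. X \<subseteq> {a, a + 1}"
  proof (cases "X = {}")
    case False
    then obtain i where i: "i \<in> X" by blast
    show ?thesis
    proof (cases "i - 1 \<in> X")
      case True
      have "X \<subseteq> {i - 1, i - 1 + 1}"
      proof
        fix j assume j: "j \<in> X"
        have "j \<le> i" using assms[OF True j] by linarith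
        moreover have "j \<ge> i - 1" using assms[OF j i] by linarith
        ultimately show "j \<in> {i - 1, i - 1 + 1}" by auto
      qed
      then show ?thesis by blast
    next
      case False
      have "X \<subseteq> {i, i + 1}"
      proof
        fix j assume j: "j \<in> X"
        have "j \<noteq> i - 1" using j False by auto
        then show "j \<in> {i, i + 1}"
          using assms[OF j i] assms[OF i j] by (cases i j rule: linorder_cases) auto
      qed
      then show ?thesis by blast
    qed
  qed simp
  then obtain a where a: "X \<subseteq> {a, a + 1}" by blast
  then show "finite X" by (rule finite_subset) simp
  have "card X \<le> card {a, a + 1}" using a by (intro card_mono) auto
  then show "card X \<le> 2" by simp
qed

text \<open>Integration of the pointwise count \<open>mult\<close>; the weight 2 is reserved for the
  set where two of the \<open>A i\<close> may overlap.\<close>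

lemma sum_measure_le_of_multiplicity:
  fixes A :: "'i \<Rightarrow> 'a set" and F :: "'k \<Rightarrow> 'a set"
  assumes I: "finite I" and K: "finite K"
    and A: "\<And>i. i \<in> I \<Longrightarrow> A i \<in> fmeasurable M"
    and F: "\<And>k. k \<in> K \<Longrightarrow> F k \<in> fmeasurable M" and N: "N \<in> fmeasurable M"
    and mult: "\<And>p. real (card {i \<in> I. p \<in> A i}) \<le> 2 * indicat_real N p + (\<Sum>k\<in>K. indicat_real (F k) p)"
  shows "(\<Sum>i\<in>I. measure M (A i)) \<le> 2 * measure M N + (\<Sum>k\<in>K. measure M (F k))"
proof -
  have int: "integrable M (indicat_real X)" "(\<integral>p. indicat_real X p \<partial>M) = measure M X"
    if "X \<in> fmeasurable M" for X
    using that fmeasurableD[OF that] by (auto simp: fmeasurable_def)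
  have "(\<Sum>i\<in>I. measure M (A i)) = (\<integral>p. (\<Sum>i\<in>I. indicat_real (A i) p) \<partial>M)"
    using A int by (subst Bochner_Integration.integral_sum) auto
  also have "\<dots> \<le> (\<integral>p. 2 * indicat_real N p + (\<Sum>k\<in>K. indicat_real (F k) p) \<partial>M)"
  proof (rule integral_mono)
    show "integrable M (\<lambda>p. \<Sum>i\<in>I. indicat_real (A i) p)" using A int by auto
    show "integrable M (\<lambda>p. 2 * indicat_real N p + (\<Sum>k\<in>K. indicat_real (F k) p))"
      using F N int by auto
    fix p
    have "(\<Sum>i\<in>I. indicat_real (A i) p) = (\<Sum>i\<in>I. if p \<in> A i then 1 else 0)"
      by (simp add: indicator_def of_bool_def)
    also have "\<dots> = real (card {i \<in> I. p \<in> A i})"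
      using I by (simp add: sum.If_cases Int_def)
    finally show "(\<Sum>i\<in>I. indicat_real (A i) p) \<le> 2 * indicat_real N p + (\<Sum>k\<in>K. indicat_real (F k) p)"
      using mult[of p] by simp
  qed
  also have "\<dots> = 2 * measure M N + (\<Sum>k\<in>K. measure M (F k))"
    using F N int by (subst Bochner_Integration.integral_add) (auto simp: Bochner_Integration.integral_sum)
  finally show ?thesis .
qed

context expanding_family begin

text \<open>Half the gap between consecutive levels of \<Psi>, and at the same time the shortest
  half side of \<Omega>; both readings limit the admissible \<epsilon> and \<delta>.\<close>

definition c0 :: real where "c0 = \<gamma> ^ (CARD('n) - 1) * L"

text \<open>The last coordinate of S raised by \<gamma>^(k-1) * \<theta>, before reduction modulo 2
  * c0. It does not involve j, so neighbouring branches are compared through one function.\<close>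

definition \<Psi> :: "real \<Rightarrow> (real, 'n) vec \<Rightarrow> real" where
  "\<Psi> \<theta> u = \<gamma> ^ (CARD('n) - 1) * (\<theta> + \<Phi>0 (Gam \<gamma> u))"

text \<open>The preimage in summand j of \<open>Gx\<close>, before intersection with the
  ball.\<close>

definition A :: "real \<Rightarrow> real \<Rightarrow> int \<Rightarrow> (real, 'n) vec set" where
  "A \<theta> \<epsilon> j = {v \<in> V \<theta> j. T \<theta> j v \<in> nbhd \<epsilon> (frontier (T \<theta> j ` U \<theta> j))}"

text \<open>Nearness to a level is measured by values of \<Psi>, not by distance in the domain, so
  \<open>\<Psi>_expand\<close> bounds slices directly. The box with margin \<beta> / 2 is where the
  Lipschitz bound for S is available.\<close>

definition level_nbhd :: "real \<Rightarrow> real \<Rightarrow> (real, 'n) vec set" where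
  "level_nbhd \<theta> \<epsilon> = {p \<in> Omega_r \<gamma> L (\<beta> / 2). \<exists>m::int. \<bar>\<Psi> \<theta> p - (2 * of_int m - 1) * c0\<bar> < \<epsilon>}"

text \<open>The absolute value joins the two opposite faces of direction i in one set, so there are
  k such sets in all.\<close>

definition face_nbhd :: "real \<Rightarrow> 'n \<Rightarrow> (real, 'n) vec set" where
  "face_nbhd \<epsilon> i = {p. \<bar>\<bar>p $ i\<bar> - L * \<gamma> ^ pos i\<bar> \<le> \<epsilon> / sqrt \<sigma>}"

lemma c0_pos: "c0 > 0"
  using L \<gamma> by (simp add: c0_def)

lemma c0_le: "c0 \<le> L * \<gamma> ^ pos (i :: 'n)"
proof -
  have "pos i \<le> CARD('n) - 1" using pos_less[of i] by simp
  then have "\<gamma> ^ (CARD('n) - 1) \<le> \<gamma> ^ pos i" using \<gamma> by (intro power_decreasing) auto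
  then show ?thesis using L by (simp add: c0_def mult.commute)
qed

lemma \<Psi>_diff_le: "\<bar>\<Psi> \<theta> p - \<Psi> \<theta> q\<bar> \<le> dist (S p) (S q)"
proof -
  have "\<Psi> \<theta> p - \<Psi> \<theta> q = (S p - S q) $ crd (CARD('n) - 1)"
    unfolding vector_minus_component S_last by (simp add: \<Psi>_def algebra_simps)
  then show ?thesis using component_le_norm_cart[of "S p - S q" "crd (CARD('n) - 1)"] by (simp add: dist_norm)
qed

text \<open>A nearby frontier point of the image is the image of some q in the frontier of U, by
  \<open>frontier_image_T\<close>. Expansion bounds dist p q, while \<Psi>, a coordinate of S up to
  a constant, changes by less than \<epsilon>; q itself stays in the closed strip of branch
  j.\<close>

lemma A_point:
  assumes "p \<in> A \<theta> \<epsilon> j"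
  obtains q where "p \<in> Omega_r \<gamma> L (\<beta> / 2)" "q \<in> frontier (U \<theta> j)" "dist p q \<le> \<epsilon> / sqrt \<sigma>"
    "\<bar>\<Psi> \<theta> p - \<Psi> \<theta> q\<bar> < \<epsilon>" "(2 * of_int j - 1) * c0 \<le> \<Psi> \<theta> q" "\<Psi> \<theta> q \<le> (2 * of_int j + 1) * c0"
proof -
  have pV: "p \<in> V \<theta> j" using assms by (simp add: A_def)
  obtain y where y: "y \<in> frontier (T \<theta> j ` U \<theta> j)" "dist (T \<theta> j p) y < \<epsilon>"
    using assms by (auto simp: A_def nbhd_def)
  obtain q where q: "q \<in> frontier (U \<theta> j)" "y = T \<theta> j q"
    using subsetD[OF frontier_image_T y(1)] by (elim imageE)
  have d: "dist (S p) (S q) < \<epsilon>" using y(2) q(2) by (simp add: dist_T)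
  have g: "\<gamma> ^ (CARD('n) - 1) \<ge> 0" using \<gamma> by simp
  show ?thesis
  proof (rule that[OF _ q(1)])
    show "p \<in> Omega_r \<gamma> L (\<beta> / 2)" using pV V_subset(1) by (rule rev_subsetD)
    have "sqrt \<sigma> * dist p q \<le> dist (S p) (S q)"
      by (rule expand[OF subsetD[OF V_subset(2) pV] subsetD[OF half_subset(3) frontier_U(1)[OF q(1)]]])
    then show "dist p q \<le> \<epsilon> / sqrt \<sigma>" using d \<sigma> by (simp add: pos_le_divide_eq mult.commute)
    show "\<bar>\<Psi> \<theta> p - \<Psi> \<theta> q\<bar> < \<epsilon>" using \<Psi>_diff_le d by (rule le_less_trans)
    show "(2 * of_int j - 1) * c0 \<le> \<Psi> \<theta> q"
      using mult_left_mono[OF frontier_U(2)[OF q(1)] g] by (simp add: \<Psi>_def c0_def mult_ac)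
    show "\<Psi> \<theta> q \<le> (2 * of_int j + 1) * c0"
      using mult_left_mono[OF frontier_U(3)[OF q(1)] g] by (simp add: \<Psi>_def c0_def mult_ac)
  qed
qed

text \<open>The level (2 i + 1) * c0 separates the \<Psi>-values of the two frontier points, and
  both values are within \<epsilon> of \<Psi> at p. For j \<ge> i + 2 these values would be at least
  2 * c0 apart, although they differ by less than 2 * \<epsilon> \<le> 2 * c0.\<close>

lemma A_pair:
  assumes \<epsilon>: "\<epsilon> \<le> c0" and p: "p \<in> A \<theta> \<epsilon> i" "p \<in> A \<theta> \<epsilon> j" and ij: "i < j"
  shows "p \<in> level_nbhd \<theta> \<epsilon>" "j \<le> i + 1"
proof -
  obtain q where q: "p \<in> Omega_r \<gamma> L (\<beta> / 2)" "\<bar>\<Psi> \<theta> p - \<Psi> \<theta> q\<bar> < \<epsilon>" "\<Psi> \<theta> q \<le> (2 * of_int i + 1) * c0"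
    using A_point[OF p(1)] by metis
  obtain r where r: "\<bar>\<Psi> \<theta> p - \<Psi> \<theta> r\<bar> < \<epsilon>" "(2 * of_int j - 1) * c0 \<le> \<Psi> \<theta> r"
    using A_point[OF p(2)] by metis
  have "(2 * of_int i + 1) * c0 \<le> (2 * of_int j - 1) * c0"
    using c0_pos ij by (intro mult_right_mono) auto
  then have "\<bar>\<Psi> \<theta> p - (2 * of_int (i + 1) - 1) * c0\<bar> < \<epsilon>"
    using q r by (simp add: algebra_simps)
  then show "p \<in> level_nbhd \<theta> \<epsilon>" using q(1) unfolding level_nbhd_def by blast
  show "j \<le> i + 1"
  proof (rule ccontr)
    assume "\<not> j \<le> i + 1"
    then have "(2 * of_int i + 1 + 2) * c0 \<le> (2 * of_int j - 1) * c0"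
      using c0_pos by (intro mult_right_mono) auto
    then show False using q r \<epsilon> by (simp add: algebra_simps)
  qed
qed

text \<open>The frontier point supplied by \<open>A_point\<close> lies on a face or on a level, and
  the latter would put p in \<open>level_nbhd\<close>.\<close>

lemma A_in_face:
  assumes p: "p \<in> A \<theta> \<epsilon> j" and n: "p \<notin> level_nbhd \<theta> \<epsilon>"
  shows "\<exists>i. p \<in> face_nbhd \<epsilon> i"
proof -
  obtain q where q: "p \<in> Omega_r \<gamma> L (\<beta> / 2)" "q \<in> frontier (U \<theta> j)" "dist p q \<le> \<epsilon> / sqrt \<sigma>"
    "\<bar>\<Psi> \<theta> p - \<Psi> \<theta> q\<bar> < \<epsilon>"
    using A_point[OF p] by metis
  have "\<theta> + \<Phi>0 (Gam \<gamma> q) \<noteq> (2 * of_int m - 1) * L" for m :: int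
  proof
    assume "\<theta> + \<Phi>0 (Gam \<gamma> q) = (2 * of_int m - 1) * L"
    then have "\<Psi> \<theta> q = (2 * of_int m - 1) * c0" by (simp add: \<Psi>_def c0_def)
    then have "p \<in> level_nbhd \<theta> \<epsilon>" using q(1,4) unfolding level_nbhd_def by auto
    then show False using n by simp
  qed
  then obtain i where i: "\<bar>q $ i\<bar> = L * \<gamma> ^ pos i" using frontier_U(4)[OF q(2)] by blast
  have "\<bar>\<bar>p $ i\<bar> - \<bar>q $ i\<bar>\<bar> \<le> \<bar>(p - q) $ i\<bar>" by simp
  also have "\<dots> \<le> dist p q" unfolding dist_norm by (rule component_le_norm_cart)
  finally have "p \<in> face_nbhd \<epsilon> i" using i q(3) by (simp add: face_nbhd_def)
  then show ?thesis ..
qed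

text \<open>Origin of k + 2: only the level set carries weight 2. Away from it p belongs to at most
  one of the sets \<open>A\<close>, and a single face term pays for that one.\<close>

lemma multiplicity_le:
  assumes \<epsilon>: "\<epsilon> \<le> c0"
  shows "real (card {j \<in> J \<theta>. p \<in> A \<theta> \<epsilon> j \<inter> B})
    \<le> 2 * indicat_real (level_nbhd \<theta> \<epsilon> \<inter> B) p + (\<Sum>i\<in>UNIV. indicat_real (face_nbhd \<epsilon> i \<inter> B) p)"
proof (cases "p \<in> B")
  case True
  let ?X = "{j \<in> J \<theta>. p \<in> A \<theta> \<epsilon> j \<inter> B}"
  have X: "finite ?X" "card ?X \<le> 2"
    by (rule card_le_2_of_close_ints; use A_pair(2)[OF \<epsilon>] in auto)+
  show ?thesis
  proof (cases "p \<in> level_nbhd \<theta> \<epsilon>")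
    case lv: True
    have "0 \<le> (\<Sum>i\<in>UNIV. indicat_real (face_nbhd \<epsilon> i \<inter> B) p)" by (intro sum_nonneg) auto
    then show ?thesis using X(2) lv True by simp
  next
    case nlv: False
    show ?thesis
    proof (cases "?X = {}")
      case True
      then show ?thesis by (simp only: card.empty) (auto intro!: sum_nonneg add_nonneg_nonneg)
    next
      case False
      then obtain j where j: "j \<in> J \<theta>" "p \<in> A \<theta> \<epsilon> j" by auto
      have "?X \<subseteq> {j}"
      proof
        fix i assume "i \<in> ?X"
        then have "p \<in> A \<theta> \<epsilon> i" by simp
        then show "i \<in> {j}"
          using A_pair(1)[OF \<epsilon> _ j(2), of i] A_pair(1)[OF \<epsilon> j(2), of i] nlv
          by (cases i j rule: linorder_cases) auto
      qed
      then have "card ?X \<le> 1" using card_mono[of "{j}" ?X] by simp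
      moreover obtain i where i: "p \<in> face_nbhd \<epsilon> i" using A_in_face[OF j(2) nlv] by blast
      have "indicat_real (face_nbhd \<epsilon> i \<inter> B) p \<le> (\<Sum>i\<in>UNIV. indicat_real (face_nbhd \<epsilon> i \<inter> B) p)"
        by (rule member_le_sum) auto
      then have "1 \<le> (\<Sum>i\<in>UNIV. indicat_real (face_nbhd \<epsilon> i \<inter> B) p)" using i True by simp
      ultimately show ?thesis using nlv by simp
    qed
  qed
qed (simp add: sum_nonneg)

section \<open>Slice lengths of the face and level neighbourhoods\<close>

lemma face_slice:
  assumes R: "R \<le> e" "\<epsilon> \<le> e" "e \<le> c0 / 2" and \<epsilon>: "\<epsilon> > 0"
    and p: "p \<in> face_nbhd \<epsilon> i \<inter> ball x R" "p + t *\<^sub>R axis i 1 \<in> face_nbhd \<epsilon> i \<inter> ball x R"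
  shows "\<bar>t\<bar> \<le> 2 * \<epsilon> / sqrt \<sigma>"
proof -
  have "\<bar>t\<bar> = dist p (p + t *\<^sub>R axis i 1)" by (simp add: dist_norm)
  also have "\<dots> < 2 * R" using p dist_triangle2[of p "p + t *\<^sub>R axis i 1" x] by (auto simp: dist_commute)
  finally have "\<bar>t\<bar> < 2 * R" .
  moreover have "\<bar>\<bar>p $ i\<bar> - L * \<gamma> ^ pos i\<bar> \<le> \<epsilon> / sqrt \<sigma>" "\<bar>\<bar>p $ i + t\<bar> - L * \<gamma> ^ pos i\<bar> \<le> \<epsilon> / sqrt \<sigma>"
    using p by (auto simp: face_nbhd_def)
  moreover have "\<epsilon> / sqrt \<sigma> < \<epsilon>" using \<epsilon> \<sigma> by (simp add: pos_divide_less_eq)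
  moreover have "c0 \<le> L * \<gamma> ^ pos i" by (rule c0_le)
  \<comment> \<open>Values v and v + t near opposite faces would differ by more than 2 * (c0 -
    \<epsilon>) \<ge> c0, whereas |t| < 2 * R \<le> c0. So both are near the same face, and differ
    by at most 2 * a.\<close>
  moreover have "\<bar>t\<bar> \<le> 2 * a" if "\<bar>t\<bar> < 2 * R" "\<bar>\<bar>v\<bar> - d\<bar> \<le> a" "\<bar>\<bar>v + t\<bar> - d\<bar> \<le> a" "a < \<epsilon>" "c0 \<le> d" for a d v
    using that R by linarith
  ultimately show ?thesis by fastforce
qed

text \<open>Moving in the first coordinate changes only the last coordinate of S, so the
  expansion of S becomes a lower bound for the derivative of \<Psi>.\<close>

lemma \<Psi>_expand:
  assumes p: "p \<in> Omega_r \<gamma> L \<beta>" "p + t *\<^sub>R axis (crd 0) 1 \<in> Omega_r \<gamma> L \<beta>"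
  shows "sqrt \<sigma> * \<bar>t\<bar> \<le> \<bar>\<Psi> \<theta> (p + t *\<^sub>R axis (crd 0) 1) - \<Psi> \<theta> p\<bar>"
proof -
  let ?p = "p + t *\<^sub>R axis (crd 0) 1"
  have ne: "crd (Suc m) \<noteq> (crd 0 :: 'n)" if "Suc m < CARD('n)" for m
    using pos_crd[where 'n='n, of "Suc m"] pos_crd[where 'n='n, of 0] that by auto
  have "S ?p - S p = axis (crd (CARD('n) - 1)) (\<Psi> \<theta> ?p - \<Psi> \<theta> p)"
  proof (rule vec_eq_iff[THEN iffD2], rule allI)
    fix i :: 'n
    show "(S ?p - S p) $ i = axis (crd (CARD('n) - 1)) (\<Psi> \<theta> ?p - \<Psi> \<theta> p) $ i"
    proof (cases "pos i + 1 < CARD('n)")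
      case True
      then have "i \<noteq> crd (CARD('n) - 1)" using pos_crd[where 'n='n, of "CARD('n) - 1"] by auto
      then show ?thesis using True ne[of "pos i"] by (simp add: Smap_def axis_def)
    next
      case False
      then have "pos i = CARD('n) - 1" using pos_less[of i] by simp
      then have i: "i = crd (CARD('n) - 1)" by (metis crd_pos)
      show ?thesis unfolding i vector_minus_component S_last by (simp add: \<Psi>_def algebra_simps)
    qed
  qed
  then have "dist (S ?p) (S p) = \<bar>\<Psi> \<theta> ?p - \<Psi> \<theta> p\<bar>" by (simp add: dist_norm norm_axis)
  moreover have "dist ?p p = \<bar>t\<bar>" by (simp add: dist_norm)
  ultimately show ?thesis using expand[OF p(2,1)] by simp
qed

text \<open>Distinct levels are at least 2 * c0 apart, but along the slice \<Psi> varies by at most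
  2 * B * e, which together with two errors below \<epsilon> stays below 2 * (1 + B) * e \<le> 2 *
  c0. So both points are near one level, their \<Psi>-values differ by less than 2 * \<epsilon>, and
  \<open>\<Psi>_expand\<close> converts this into the bound on t.\<close>

lemma level_slice:
  assumes B: "\<And>x y. x \<in> Omega \<gamma> (L + \<beta> / 2) \<Longrightarrow> y \<in> Omega \<gamma> (L + \<beta> / 2) \<Longrightarrow> dist (S x) (S y) \<le> B * dist x y"
      "B \<ge> 1"
    and R: "R \<le> e" "\<epsilon> \<le> e" "(1 + B) * e \<le> c0"
    and p: "p \<in> level_nbhd \<theta> \<epsilon> \<inter> ball x R" "p + t *\<^sub>R axis (crd 0) 1 \<in> level_nbhd \<theta> \<epsilon> \<inter> ball x R"
  shows "\<bar>t\<bar> \<le> 2 * \<epsilon> / sqrt \<sigma>"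
proof -
  let ?p = "p + t *\<^sub>R axis (crd 0) 1"
  obtain m m' :: int where m: "\<bar>\<Psi> \<theta> p - (2 * of_int m - 1) * c0\<bar> < \<epsilon>"
    "\<bar>\<Psi> \<theta> ?p - (2 * of_int m' - 1) * c0\<bar> < \<epsilon>"
    using p by (auto simp: level_nbhd_def)
  have pp: "p \<in> Omega_r \<gamma> L (\<beta> / 2)" "?p \<in> Omega_r \<gamma> L (\<beta> / 2)" using p by (auto simp: level_nbhd_def)
  note pC = pp[THEN subsetD[OF Omega_r_subset_Omega[OF \<gamma>(1)]]]
  have "dist ?p p < 2 * R" using p dist_triangle2[of ?p p x] by (auto simp: dist_commute)
  then have "dist ?p p \<le> 2 * e" using R by simp
  have "\<bar>\<Psi> \<theta> ?p - \<Psi> \<theta> p\<bar> \<le> dist (S ?p) (S p)" by (rule \<Psi>_diff_le)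
  also have "\<dots> \<le> B * dist ?p p" by (rule B(1)[OF pC(2,1)])
  also have "\<dots> \<le> B * (2 * e)" using B(2) \<open>dist ?p p \<le> 2 * e\<close> by (intro mult_left_mono) auto
  finally have *: "\<bar>\<Psi> \<theta> ?p - \<Psi> \<theta> p\<bar> \<le> B * (2 * e)" .
  have "m = m'"
  proof (rule ccontr)
    assume "m \<noteq> m'"
    then have "1 \<le> \<bar>real_of_int m' - of_int m\<bar>" by linarith
    then have "2 * c0 * 1 \<le> 2 * c0 * \<bar>real_of_int m' - of_int m\<bar>" using c0_pos by (intro mult_left_mono) auto
    also have "\<dots> = \<bar>(2 * of_int m' - 1) * c0 - (2 * of_int m - 1) * c0\<bar>"
    proof -
      have "(2 * of_int m' - 1) * c0 - (2 * of_int m - 1) * c0 = 2 * c0 * (real_of_int m' - of_int m)"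
        by (simp add: algebra_simps)
      then show ?thesis using c0_pos by (simp add: abs_mult)
    qed
    also have "\<dots> < 2 * \<epsilon> + B * (2 * e)" using m * by linarith
    also have "\<dots> \<le> 2 * ((1 + B) * e)" using R by (simp add: algebra_simps)
    also have "\<dots> \<le> 2 * c0" using R by simp
    finally show False by simp
  qed
  then have "\<bar>\<Psi> \<theta> ?p - \<Psi> \<theta> p\<bar> < 2 * \<epsilon>" using m by auto
  moreover have "sqrt \<sigma> * \<bar>t\<bar> \<le> \<bar>\<Psi> \<theta> ?p - \<Psi> \<theta> p\<bar>"
    using pp half_subset(2) by (intro \<Psi>_expand) auto
  ultimately show ?thesis using \<sigma> by (simp add: pos_le_divide_eq mult.commute)
qed

section \<open>Measurability and the bounds for G and eta\<close>

lemma continuous_\<Psi>: "continuous_on (Omega_r \<gamma> L \<beta>) (\<Psi> \<theta>)"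
  unfolding \<Psi>_def[abs_def] by (intro continuous_intros continuous_Phi)

lemma open_level_nbhd: "open (level_nbhd \<theta> \<epsilon>)"
proof -
  have "level_nbhd \<theta> \<epsilon> = (\<Union>m::int. Omega_r \<gamma> L (\<beta> / 2) \<inter> \<Psi> \<theta> -` ball ((2 * of_int m - 1) * c0) \<epsilon>)"
    by (auto simp: level_nbhd_def dist_norm abs_minus_commute)
  also have "open \<dots>"
    by (intro open_UN ballI continuous_open_preimage continuous_on_subset[OF continuous_\<Psi> half_subset(2)])
       (use open_Omega_r \<gamma> in auto)
  finally show ?thesis .
qed

lemma closed_face_nbhd: "closed (face_nbhd \<epsilon> i)"
  unfolding face_nbhd_def by (intro closed_Collect_le continuous_intros)

lemma open_A: "open (A \<theta> \<epsilon> j)"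
proof -
  have "A \<theta> \<epsilon> j = V \<theta> j \<inter> T \<theta> j -` nbhd \<epsilon> (frontier (T \<theta> j ` U \<theta> j))" by (auto simp: A_def)
  also have "open \<dots>"
    by (intro continuous_open_preimage continuous_on_subset[OF continuous_T V_subset(2)] open_V open_nbhd)
  finally show ?thesis .
qed

text \<open>Each of the k + 2 pieces, counted with weight, has measure at most \<open>w\<close>;
  dividing by the volume of the ball cancels R^(k-1) and leaves one factor 1 / R.\<close>

lemma Gx_le:
  assumes B: "\<And>x y. x \<in> Omega \<gamma> (L + \<beta> / 2) \<Longrightarrow> y \<in> Omega \<gamma> (L + \<beta> / 2) \<Longrightarrow> dist (S x) (S y) \<le> B * dist x y"
      "B \<ge> 1"
    and e: "0 < \<epsilon>" "\<epsilon> \<le> \<delta>" "(1 + B) * \<delta> \<le> c0"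
  shows "Gx \<gamma> L \<Phi>0 \<theta> \<sigma> \<epsilon>m x \<epsilon> \<delta> \<le> (real CARD('n) + 2) * (2 * \<epsilon> / sqrt \<sigma>) *
    (unit_ball_vol (real CARD('n) - 1) / unit_ball_vol (real CARD('n))) / ((1 - \<sigma> powr (-1/2)) * \<delta>)"
proof -
  define s where "s = \<sigma> powr (-1/2)"
  have s: "0 < s" "s < 1" using \<sigma> powr_minus_half[of \<sigma>] by (simp_all add: s_def)
  define R where "R = (1 - s) * \<delta>"
  have R: "R > 0" "R \<le> \<delta>" using s e by (simp_all add: R_def mult_left_le_one_le)
  define w where "w = 2 * \<epsilon> / sqrt \<sigma> * (unit_ball_vol (real CARD('n) - 1) * R ^ (CARD('n) - 1))"
  \<comment> \<open>As B \<ge> 1, the smallness condition made for levels also contains the one for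
    faces, \<delta> \<le> c0 / 2.\<close>
  have "2 * \<delta> \<le> (1 + B) * \<delta>" using B(2) e by (intro mult_right_mono) auto
  from order_trans[OF this e(3)] have d2: "\<delta> \<le> c0 / 2" by simp
  then have ec: "\<epsilon> \<le> c0" using e c0_pos by simp
  have l: "2 * \<epsilon> / sqrt \<sigma> \<ge> 0" using e \<sigma> by simp
  let ?B = "ball x R"
  have fm: "X \<inter> ?B \<in> lmeasurable" if "X \<in> sets borel" for X
    using that by (intro bounded_set_imp_lmeasurable bounded_Int) auto
  have mf: "measure lebesgue (face_nbhd \<epsilon> i \<inter> ?B) \<le> w" for i
  proof -
    have "measure lebesgue (face_nbhd \<epsilon> i \<inter> ?B)
        \<le> 2 * \<epsilon> / sqrt \<sigma> * (unit_ball_vol (real DIM((real, 'n) vec) - 1) * R ^ (DIM((real, 'n) vec) - 1))"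
    proof (rule measure_le_of_thin_slices[OF _ Int_lower2 R(1) _ l])
      show "face_nbhd \<epsilon> i \<inter> ?B \<in> sets borel"
        using borel_closed[OF closed_face_nbhd] borel_open[OF open_ball] by (rule sets.Int)
      show "axis i 1 \<in> (Basis :: (real, 'n) vec set)" by simp
      show "\<bar>t\<bar> \<le> 2 * \<epsilon> / sqrt \<sigma>"
        if "p \<in> face_nbhd \<epsilon> i \<inter> ?B" "p + t *\<^sub>R axis i 1 \<in> face_nbhd \<epsilon> i \<inter> ?B" for p t
        by (rule face_slice[OF R(2) e(2) d2 e(1) that])
    qed
    then show ?thesis by (simp add: w_def)
  qed
  have mn: "measure lebesgue (level_nbhd \<theta> \<epsilon> \<inter> ?B) \<le> w"
  proof -
    have "measure lebesgue (level_nbhd \<theta> \<epsilon> \<inter> ?B)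
        \<le> 2 * \<epsilon> / sqrt \<sigma> * (unit_ball_vol (real DIM((real, 'n) vec) - 1) * R ^ (DIM((real, 'n) vec) - 1))"
    proof (rule measure_le_of_thin_slices[OF _ Int_lower2 R(1) _ l])
      show "level_nbhd \<theta> \<epsilon> \<inter> ?B \<in> sets borel"
        by (rule borel_open[OF open_Int[OF open_level_nbhd open_ball]])
      show "axis (crd 0) 1 \<in> (Basis :: (real, 'n) vec set)" by simp
      show "\<bar>t\<bar> \<le> 2 * \<epsilon> / sqrt \<sigma>"
        if "p \<in> level_nbhd \<theta> \<epsilon> \<inter> ?B" "p + t *\<^sub>R axis (crd 0) 1 \<in> level_nbhd \<theta> \<epsilon> \<inter> ?B" for p t
        by (rule level_slice[OF B R(2) e(2,3) that])
    qed
    then show ?thesis by (simp add: w_def)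
  qed
  have "(\<Sum>j\<in>J \<theta>. measure lebesgue (A \<theta> \<epsilon> j \<inter> ?B))
      \<le> 2 * measure lebesgue (level_nbhd \<theta> \<epsilon> \<inter> ?B) + (\<Sum>i\<in>UNIV. measure lebesgue (face_nbhd \<epsilon> i \<inter> ?B))"
    by (rule sum_measure_le_of_multiplicity[OF finite_J finite _ _ _ multiplicity_le[OF ec]])
       (rule fm[OF borel_open[OF open_A]] fm[OF borel_closed[OF closed_face_nbhd]]
          fm[OF borel_open[OF open_level_nbhd]])+
  also have "\<dots> \<le> 2 * w + (\<Sum>i\<in>(UNIV :: 'n set). w)"
    by (intro add_mono mult_left_mono sum_mono mn mf) auto
  finally have sum: "(\<Sum>j\<in>J \<theta>. measure lebesgue (A \<theta> \<epsilon> j \<inter> ?B)) \<le> (real CARD('n) + 2) * w"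
    by (simp add: algebra_simps)
  have mB: "measure lebesgue ?B = unit_ball_vol (real CARD('n)) * R ^ CARD('n)"
    using content_ball[of R x] R(1) by simp
  have mB_pos: "measure lebesgue ?B > 0" unfolding mB using R by simp
  have "Gx \<gamma> L \<Phi>0 \<theta> \<sigma> \<epsilon>m x \<epsilon> \<delta> = (\<Sum>j\<in>J \<theta>. measure lebesgue (A \<theta> \<epsilon> j \<inter> ?B)) / measure lebesgue ?B"
    unfolding Gx_def A_def R_def s_def by (simp add: sum_divide_distrib)
  also have "\<dots> \<le> (real CARD('n) + 2) * w / measure lebesgue ?B"
    using sum mB_pos by (intro divide_right_mono) auto
  also have "\<dots> = (real CARD('n) + 2) * (2 * \<epsilon> / sqrt \<sigma>) *
    (unit_ball_vol (real CARD('n) - 1) / unit_ball_vol (real CARD('n))) / R"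
  proof -
    have "R ^ CARD('n) = R * R ^ (CARD('n) - 1)" using power_minus_mult[of "CARD('n)" R] by (simp add: mult.commute)
    then show ?thesis using R unfolding mB w_def by simp
  qed
  finally show ?thesis by (simp only: R_def s_def)
qed

text \<open>The bound for G is linear in \<epsilon> / \<delta>, so dividing by \<epsilon> and
  multiplying by \<delta> leaves a constant. With s = 1 / sqrt \<sigma> it becomes the second term
  of \<open>eta0\<close> because s / (1 - s) = 1 / (sqrt \<sigma> - 1).\<close>

lemma eta_le:
  assumes B: "\<And>x y. x \<in> Omega \<gamma> (L + \<beta> / 2) \<Longrightarrow> y \<in> Omega \<gamma> (L + \<beta> / 2) \<Longrightarrow> dist (S x) (S y) \<le> B * dist x y"
      "B \<ge> 1"
    and d: "0 < \<delta>" "(1 + B) * \<delta> \<le> c0"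
  shows "eta \<gamma> L \<Phi>0 \<theta> \<sigma> \<epsilon>m \<delta> \<le> ereal (eta0 CARD('n) \<sigma> (real CARD('n) + 2))"
proof -
  define s where "s = \<sigma> powr (-1/2)"
  have s_eq: "s = 1 / sqrt \<sigma>" using \<sigma> powr_minus_half[of \<sigma>] by (simp add: s_def)
  have s: "0 < s" "s < 1" using \<sigma> by (simp_all add: s_eq)
  define r where "r = unit_ball_vol (real CARD('n) - 1) / unit_ball_vol (real CARD('n))"
  define D where "D = (real CARD('n) + 2) * (2 * s) * r / (1 - s)"
  have "Gsup \<gamma> L \<Phi>0 \<theta> \<sigma> \<epsilon>m \<epsilon> \<delta> / ereal \<epsilon> \<le> ereal (D / \<delta>)" if \<epsilon>: "\<epsilon> \<in> {0<..\<delta>}" for \<epsilon>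
  proof -
    have "Gsup \<gamma> L \<Phi>0 \<theta> \<sigma> \<epsilon>m \<epsilon> \<delta> \<le> ereal (D / \<delta> * \<epsilon>)"
      unfolding Gsup_def
    proof (rule SUP_least)
      fix x
      have "Gx \<gamma> L \<Phi>0 \<theta> \<sigma> \<epsilon>m x \<epsilon> \<delta> \<le> (real CARD('n) + 2) * (2 * \<epsilon> / sqrt \<sigma>) * r / ((1 - s) * \<delta>)"
        unfolding r_def s_def using \<epsilon> d by (intro Gx_le[OF B]) auto
      also have "(real CARD('n) + 2) * (2 * \<epsilon> / sqrt \<sigma>) * r / ((1 - s) * \<delta>) = D / \<delta> * \<epsilon>"
      proof -
        have "a * (2 * \<epsilon> / q) * r / (t * \<delta>) = a * (2 * (1 / q)) * r / t / \<delta> * \<epsilon>" for a q t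
          by (simp add: mult_ac)
        then show ?thesis unfolding D_def s_eq .
      qed
      finally show "ereal (Gx \<gamma> L \<Phi>0 \<theta> \<sigma> \<epsilon>m x \<epsilon> \<delta>) \<le> ereal (D / \<delta> * \<epsilon>)" by simp
    qed
    then have "Gsup \<gamma> L \<Phi>0 \<theta> \<sigma> \<epsilon>m \<epsilon> \<delta> / ereal \<epsilon> \<le> ereal (D / \<delta> * \<epsilon>) / ereal \<epsilon>"
      using \<epsilon> by (intro ereal_divide_right_mono) auto
    then show ?thesis using \<epsilon> by simp
  qed
  then have "(SUP \<epsilon>\<in>{0<..\<delta>}. Gsup \<gamma> L \<Phi>0 \<theta> \<sigma> \<epsilon>m \<epsilon> \<delta> / ereal \<epsilon>) \<le> ereal (D / \<delta>)" by (rule SUP_least)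
  then have "2 * (SUP \<epsilon>\<in>{0<..\<delta>}. Gsup \<gamma> L \<Phi>0 \<theta> \<sigma> \<epsilon>m \<epsilon> \<delta> / ereal \<epsilon>) * ereal \<delta> \<le> 2 * ereal (D / \<delta>) * ereal \<delta>"
    using d by (intro ereal_mult_right_mono ereal_mult_left_mono) auto
  also have "2 * ereal (D / \<delta>) * ereal \<delta> = ereal (2 * D)"
    using d by (simp only: numeral_eq_ereal times_ereal.simps) simp
  finally have "eta \<gamma> L \<Phi>0 \<theta> \<sigma> \<epsilon>m \<delta> \<le> ereal s + ereal (2 * D)"
    unfolding eta_def s_def by (rule add_left_mono)
  also have "ereal s + ereal (2 * D) = ereal (eta0 CARD('n) \<sigma> (real CARD('n) + 2))"
  proof -
    have 4: "4 / (sqrt \<sigma> - 1) = 4 * s / (1 - s)" using \<sigma> by (simp add: s_eq field_simps)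
    show ?thesis unfolding eta0_def s_def[symmetric] D_def r_def 4 by (simp add: mult_ac)
  qed
  finally show ?thesis .
qed

end

section \<open>Choice of the constants and assembly\<close>

theorem theorem2p1:
  fixes \<Phi>0 :: "real^('n::{finite,linorder}) \<Rightarrow> real"
    and L \<beta> \<sigma> C1 C2 \<gamma> :: real
  assumes k2: "CARD('n) \<ge> 2"
    and L: "L > 0" and \<beta>: "\<beta> > 0"
    and C2Phi: "C2_on (ocube (L + \<beta>)) \<Phi>0"
    and sigma: "\<sigma> > Sk CARD('n) (real CARD('n) + 2)"
    and C1: "C1 > 1" and C2: "C2 > 1"
    and gam: "\<gamma> > 0" "1 / \<gamma>^2 = C1 * \<sigma>"
    and d1: "\<forall>x\<in>ocube (L + \<beta>). (partial \<Phi>0 0 x)^2 \<ge> C1 ^ (CARD('n) - 1) * C2 * \<sigma> ^ CARD('n)"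
    and dj: "\<forall>x\<in>ocube (L + \<beta>). \<forall>p. 1 \<le> p \<and> p < CARD('n) \<longrightarrow>
               (partial \<Phi>0 p x)^2 \<le> (C1 - 1) * (C2 - 1) / (real CARD('n) - 1) * \<sigma>"
  shows "\<exists>r0 \<epsilon>m K \<epsilon>0. r0 > 0 \<and> \<epsilon>m > 0 \<and> K > 0 \<and> \<epsilon>0 > 0 \<and>
    (\<forall>\<theta>.
      finite (Jset \<gamma> L \<Phi>0 \<theta>) \<and>
      \<comment> \<open>(PRE)\<close>
      (\<forall>i\<in>Jset \<gamma> L \<Phi>0 \<theta>. \<forall>j\<in>Jset \<gamma> L \<Phi>0 \<theta>. i \<noteq> j \<longrightarrow>
          Uset \<gamma> L \<Phi>0 \<theta> i \<inter> Uset \<gamma> L \<Phi>0 \<theta> j = {}) \<and>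
      (\<forall>j\<in>Jset \<gamma> L \<Phi>0 \<theta>.
         open (Uset \<gamma> L \<Phi>0 \<theta> j) \<and> Uset \<gamma> L \<Phi>0 \<theta> j \<subseteq> Omega \<gamma> L \<and>
         closure (Uset \<gamma> L \<Phi>0 \<theta> j) \<subseteq> Vset \<gamma> L \<Phi>0 \<theta> \<epsilon>m j \<and>
         Vset \<gamma> L \<Phi>0 \<theta> \<epsilon>m j \<subseteq> Omega_r \<gamma> L \<beta> \<and>
         C2_on (Vset \<gamma> L \<Phi>0 \<theta> \<epsilon>m j) (Tj \<gamma> L \<Phi>0 \<theta> j) \<and>
      \<comment> \<open>(PE1)\<close>
         (\<forall>u\<in>Uset \<gamma> L \<Phi>0 \<theta> j. Ttheta \<gamma> L \<Phi>0 \<theta> u = Tj \<gamma> L \<Phi>0 \<theta> j u) \<and>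
         nbhd r0 (Ttheta \<gamma> L \<Phi>0 \<theta> ` Uset \<gamma> L \<Phi>0 \<theta> j)
           \<subseteq> Tj \<gamma> L \<Phi>0 \<theta> j ` Vset \<gamma> L \<Phi>0 \<theta> \<epsilon>m j \<and>
      \<comment> \<open>(PE2)\<close>
         C2_diffeo_on (Vset \<gamma> L \<Phi>0 \<theta> \<epsilon>m j) (Tj \<gamma> L \<Phi>0 \<theta> j) \<and>
         (\<forall>\<epsilon>. 0 < \<epsilon> \<and> \<epsilon> < \<epsilon>0 \<longrightarrow>
            (\<forall>z\<in>Tj \<gamma> L \<Phi>0 \<theta> j ` Vset \<gamma> L \<Phi>0 \<theta> \<epsilon>m j.
             \<forall>x\<in>ball z \<epsilon> \<inter> Tj \<gamma> L \<Phi>0 \<theta> j ` Vset \<gamma> L \<Phi>0 \<theta> \<epsilon>m j.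
             \<forall>y\<in>ball z \<epsilon> \<inter> Tj \<gamma> L \<Phi>0 \<theta> j ` Vset \<gamma> L \<Phi>0 \<theta> \<epsilon>m j.
               \<bar>jac_det (inv_into (Vset \<gamma> L \<Phi>0 \<theta> \<epsilon>m j) (Tj \<gamma> L \<Phi>0 \<theta> j)) x
                - jac_det (inv_into (Vset \<gamma> L \<Phi>0 \<theta> \<epsilon>m j) (Tj \<gamma> L \<Phi>0 \<theta> j)) y\<bar>
               \<le> K * \<bar>jac_det (inv_into (Vset \<gamma> L \<Phi>0 \<theta> \<epsilon>m j) (Tj \<gamma> L \<Phi>0 \<theta> j)) z\<bar> * \<epsilon>)) \<and>
      \<comment> \<open>(PE4)\<close>
         (\<forall>u\<in>Tj \<gamma> L \<Phi>0 \<theta> j ` Vset \<gamma> L \<Phi>0 \<theta> \<epsilon>m j.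
          \<forall>v\<in>Tj \<gamma> L \<Phi>0 \<theta> j ` Vset \<gamma> L \<Phi>0 \<theta> \<epsilon>m j.
            dist u v \<le> \<epsilon>0 \<longrightarrow>
            dist (inv_into (Vset \<gamma> L \<Phi>0 \<theta> \<epsilon>m j) (Tj \<gamma> L \<Phi>0 \<theta> j) u)
                 (inv_into (Vset \<gamma> L \<Phi>0 \<theta> \<epsilon>m j) (Tj \<gamma> L \<Phi>0 \<theta> j) v)
              \<le> \<sigma> powr (-1/2) * dist u v)) \<and>
      \<comment> \<open>(PE3)\<close>
      emeasure lebesgue (Omega \<gamma> L - (\<Union>j\<in>Jset \<gamma> L \<Phi>0 \<theta>. Uset \<gamma> L \<Phi>0 \<theta> j)) = 0 \<and>
      \<comment> \<open>(PE5)\<close>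
      (SUP \<delta>\<in>{0<..\<epsilon>0}. eta \<gamma> L \<Phi>0 \<theta> \<sigma> \<epsilon>m \<delta>) < 1)"
proof -
  have \<sigma>: "\<sigma> > 1" and eta: "eta0 CARD('n) \<sigma> (real CARD('n) + 2) < 1"
    using Sk_less_imp[of "CARD('n)" "real CARD('n) + 2" \<sigma>] k2 sigma by auto
  have g2: "\<gamma>\<^sup>2 = 1 / (C1 * \<sigma>)" by (simp add: gam(2)[symmetric])
  have "C1 * \<sigma> > 1" using C1 \<sigma> by (simp add: less_1_mult)
  then have "\<gamma>\<^sup>2 \<le> 1" by (simp add: g2)
  then have g1: "\<gamma> \<le> 1" by (intro power2_le_imp_le[of \<gamma> 1]) auto
  have diff: "\<Phi>0 differentiable (at x)" if "x \<in> ocube (L + \<beta>)" for x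
    using C2Phi that unfolding C2_on_def differentiable_def by blast
  interpret expanding_family \<Phi>0 L \<beta> \<sigma> \<gamma>
  proof
    fix u v :: "(real, 'n) vec" assume "u \<in> Omega_r \<gamma> L \<beta>" "v \<in> Omega_r \<gamma> L \<beta>"
    then show "sqrt \<sigma> * dist u v \<le> dist (Smap \<gamma> \<Phi>0 u) (Smap \<gamma> \<Phi>0 v)"
      by (intro Smap_expanding[OF k2 diff \<sigma> C1 C2 gam d1 dj]) (simp_all add: Omega_r_def)
  qed (use L \<beta> \<sigma> gam g1 k2 C2Phi in auto)
  obtain B where B: "B \<ge> 1" "\<And>x y. x \<in> Omega \<gamma> (L + \<beta> / 2) \<Longrightarrow> y \<in> Omega \<gamma> (L + \<beta> / 2) \<Longrightarrow>
      dist (S x) (S y) \<le> B * dist x y"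
    using S_Lipschitz by auto
  obtain K where K: "K > 0"
    "\<And>\<theta> j \<epsilon> x y z. x \<in> T \<theta> j ` V \<theta> j \<Longrightarrow> y \<in> T \<theta> j ` V \<theta> j \<Longrightarrow> z \<in> T \<theta> j ` V \<theta> j \<Longrightarrow>
      dist z x < \<epsilon> \<Longrightarrow> dist z y < \<epsilon> \<Longrightarrow>
      \<bar>jac_det (inv_into (V \<theta> j) (T \<theta> j)) x - jac_det (inv_into (V \<theta> j) (T \<theta> j)) y\<bar>
        \<le> K * \<bar>jac_det (inv_into (V \<theta> j) (T \<theta> j)) z\<bar> * \<epsilon>"
    using jacobian_distortion by blast
  \<comment> \<open>The largest value for which (1 + B) * \<delta> \<le> c0 holds for all \<delta>
    up to it, as \<open>eta_le\<close> asks.\<close>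
  define \<epsilon>0 where "\<epsilon>0 = c0 / (1 + B)"
  have \<epsilon>0: "\<epsilon>0 > 0" using c0_pos B(1) by (simp add: \<epsilon>0_def)
  have d0: "(1 + B) * \<delta> \<le> c0" if "\<delta> \<le> \<epsilon>0" for \<delta>
    using that B(1) by (simp add: \<epsilon>0_def pos_le_divide_eq mult.commute)
  have eta_sup: "(SUP \<delta>\<in>{0<..\<epsilon>0}. eta \<gamma> L \<Phi>0 \<theta> \<sigma> \<epsilon>m \<delta>) < 1" for \<theta>
  proof -
    have "(SUP \<delta>\<in>{0<..\<epsilon>0}. eta \<gamma> L \<Phi>0 \<theta> \<sigma> \<epsilon>m \<delta>) \<le> ereal (eta0 CARD('n) \<sigma> (real CARD('n) + 2))"
      using d0 by (intro SUP_least eta_le[OF B(2,1)]) auto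
    \<comment> \<open>The bound for \<open>eta\<close> is one number below 1, the same for all
      \<delta>, so strictness survives the supremum.\<close>
    also have "\<dots> < 1" using eta by simp
    finally show ?thesis .
  qed
  have nbhd: "nbhd (sqrt \<sigma> * \<epsilon>m) (Ttheta \<gamma> L \<Phi>0 \<theta> ` U \<theta> j) \<subseteq> T \<theta> j ` V \<theta> j" for \<theta> j
    using nbhd_image_subset[of \<theta> j] Ttheta_eq_T by (simp cong: image_cong)
  show ?thesis
  \<comment> \<open>The witness for r0 is \<open>\<epsilon>m\<close> enlarged by the expansion
    factor, as in \<open>nbhd_image_subset\<close>.\<close>
  proof (rule exI[of _ "sqrt \<sigma> * \<epsilon>m"], rule exI[of _ \<epsilon>m], rule exI[of _ K], rule exI[of _ \<epsilon>0],
      intro conjI allI ballI impI)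
    show "sqrt \<sigma> * \<epsilon>m > 0" using \<sigma> \<epsilon>m_pos by simp
    fix \<theta> j \<epsilon> x y z
    assume "0 < \<epsilon> \<and> \<epsilon> < \<epsilon>0" "z \<in> T \<theta> j ` V \<theta> j" "x \<in> ball z \<epsilon> \<inter> T \<theta> j ` V \<theta> j" "y \<in> ball z \<epsilon> \<inter> T \<theta> j ` V \<theta> j"
    then show "\<bar>jac_det (inv_into (V \<theta> j) (T \<theta> j)) x - jac_det (inv_into (V \<theta> j) (T \<theta> j)) y\<bar>
        \<le> K * \<bar>jac_det (inv_into (V \<theta> j) (T \<theta> j)) z\<bar> * \<epsilon>"
      by (intro K(2)) auto
  qed (rule \<epsilon>m_pos K(1) \<epsilon>0 finite_J open_U U_subset(2) closure_U_subset_V V_subset(2)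
        C2_on_subset[OF C2_T V_subset(2)] nbhd C2_diffeo_T U_cover eta_sup
      | (rule U_disjoint Ttheta_eq_T inv_T_contract; assumption))+
qed

end
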